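(* Let $G$ be a double tree. Then there is a spanning tree factorization $(T_1,T_2)$ of $G$ such that $|d_{T_1}(v)-d_{T_2}(v)|\leq 5$ for all $v \in V(G)$.
   Context: Graphs are finite and may have parallel edges. For a positive integer $k$, a graph $G$ is a $k$-multiple tree if there are spanning trees $T_1,\ldots,T_k$ of $G$ that are pairwise edge-disjoint and satisfy $E(T_1)\cup\cdots\cup E(T_k)=E(G)$; the tuple $(T_1,\ldots,T_k)$ is then called a spanning tree factorization of $G$. A double tree is a $2$-multiple tree. For a subgraph $T$ and vertex $v$, $d_T(v)$ denotes the number of edges of $T$ incident to $v$. *)

theory Defs
  imports Main
begin

record ('v, 'e) multigraph =
  vertices :: "'v set"
  edges :: "'e set"
  ends :: "'e \<Rightarrow> 'v set"

text \<open>Finite undirected graphs with parallel edges and without loops. The incidence map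
  \<open>ends\<close> need not be injective; its values outside \<open>edges\<close> are irrelevant.\<close>

definition finite_multigraph :: "('v, 'e) multigraph \<Rightarrow> bool" where
  "finite_multigraph G \<longleftrightarrow> finite (vertices G) \<and> finite (edges G) \<and>
     (\<forall>e\<in>edges G. ends G e \<subseteq> vertices G \<and> card (ends G e) = 2)"

definition subgraph_of :: "('v, 'e) multigraph \<Rightarrow> ('v, 'e) multigraph \<Rightarrow> bool" where
  "subgraph_of H G \<longleftrightarrow> vertices H \<subseteq> vertices G \<and> edges H \<subseteq> edges G \<and>
     (\<forall>e\<in>edges H. ends H e = ends G e)"

definition adjacent_in :: "('v, 'e) multigraph \<Rightarrow> 'v \<Rightarrow> 'v \<Rightarrow> bool" where
  "adjacent_in G u v \<longleftrightarrow> (\<exists>e\<in>edges G. ends G e = {u, v})"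

definition connected_graph :: "('v, 'e) multigraph \<Rightarrow> bool" where
  "connected_graph G \<longleftrightarrow> vertices G \<noteq> {} \<and>
     (\<forall>u\<in>vertices G. \<forall>v\<in>vertices G. (adjacent_in G)\<^sup>*\<^sup>* u v)"

text \<open>Edge \<open>es ! i\<close> joins \<open>vs ! i\<close> to its cyclic successor. Two parallel edges form a
  cycle of length 2.\<close>

definition is_cycle :: "('v, 'e) multigraph \<Rightarrow> 'v list \<Rightarrow> 'e list \<Rightarrow> bool" where
  "is_cycle G vs es \<longleftrightarrow> length vs = length es \<and> length es \<ge> 2 \<and> distinct vs \<and> distinct es \<and>
     set es \<subseteq> edges G \<and>
     (\<forall>i<length es. ends G (es ! i) = {vs ! i, vs ! (Suc i mod length vs)})"

definition is_tree :: "('v, 'e) multigraph \<Rightarrow> bool" where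
  "is_tree T \<longleftrightarrow> finite_multigraph T \<and> connected_graph T \<and> (\<nexists>vs es. is_cycle T vs es)"

definition spanning_tree_of :: "('v, 'e) multigraph \<Rightarrow> ('v, 'e) multigraph \<Rightarrow> bool" where
  "spanning_tree_of T G \<longleftrightarrow> subgraph_of T G \<and> vertices T = vertices G \<and> is_tree T"

definition spanning_tree_factorization ::
    "('v, 'e) multigraph \<Rightarrow> ('v, 'e) multigraph list \<Rightarrow> bool" where
  "spanning_tree_factorization G Ts \<longleftrightarrow>
     (\<forall>T\<in>set Ts. spanning_tree_of T G) \<and>
     (\<forall>i<length Ts. \<forall>j<length Ts. i \<noteq> j \<longrightarrow> edges (Ts ! i) \<inter> edges (Ts ! j) = {}) \<and>
     (\<Union>T\<in>set Ts. edges T) = edges G"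

definition multiple_tree :: "nat \<Rightarrow> ('v, 'e) multigraph \<Rightarrow> bool" where
  "multiple_tree k G \<longleftrightarrow> k \<ge> 1 \<and> finite_multigraph G \<and>
     (\<exists>Ts. length Ts = k \<and> spanning_tree_factorization G Ts)"

definition double_tree :: "('v, 'e) multigraph \<Rightarrow> bool" where
  "double_tree G \<longleftrightarrow> multiple_tree 2 G"

definition vertex_degree :: "('v, 'e) multigraph \<Rightarrow> 'v \<Rightarrow> nat" where
  "vertex_degree T v = card {e \<in> edges T. v \<in> ends T e}"

end

theory Submission
  imports Defs
begin

text \<open>
  The induction is on the number of vertices and is carried out for a set \<open>H u\<close> of counted
  (``flagged'') edges at every vertex \<open>u\<close>. Besides a factorization it produces a family of
  \<^emph>\<open>links\<close>, pairs of vertices whose contributions can be flipped freely and independently, such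
  that without the links the red and blue flagged edges at each vertex differ by at most 4. A
  suitable choice of the flips leaves at most 1 from the links, which gives 5.

  Vertices of degree at most 5 need no flags since both colours occur there. A vertex of degree 2
  is deleted, and becomes a link if both its edges are flagged at their far ends. At a vertex of
  degree 3 with an edge not flagged at its far end, either the two other edges have equal colours
  in some factorization, and are merged into one edge; or they always differ, and then an exchange
  argument shows that they can be swapped in every factorization, so that they form a link. By
  discharging, one of these reductions always applies.
\<close>

section \<open>Spanning trees via closed vertex sets\<close>

text \<open>With respect to the edges in \<open>T\<close>, such an \<open>X\<close> is a union of
  connected components. Arguing with closed sets keeps paths out of everything before the final
  translation.\<close>

definition closed_under :: "('e \<Rightarrow> 'v set) \<Rightarrow> 'e set \<Rightarrow> 'v set \<Rightarrow> bool" where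
  "closed_under en T X \<longleftrightarrow> (\<forall>e\<in>T. en e \<inter> X \<noteq> {} \<longrightarrow> en e \<subseteq> X)"

text \<open>Connectedness as the absence of a cut. \<open>X\<close> may reach beyond
  \<open>V\<close>, hence inclusion instead of equality.\<close>

definition spans :: "('e \<Rightarrow> 'v set) \<Rightarrow> 'v set \<Rightarrow> 'e set \<Rightarrow> bool" where
  "spans en V T \<longleftrightarrow> (\<forall>X. closed_under en T X \<longrightarrow> V \<inter> X \<noteq> {} \<longrightarrow> V \<subseteq> X)"

definition edge_set_on :: "('e \<Rightarrow> 'v set) \<Rightarrow> 'v set \<Rightarrow> 'e set \<Rightarrow> bool" where
  "edge_set_on en V T \<longleftrightarrow> finite T \<and> (\<forall>e\<in>T. en e \<subseteq> V \<and> card (en e) = 2)"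

text \<open>Acyclicity is encoded by the number of edges of a connected graph; the equation also
  forces \<open>V\<close> to be nonempty.\<close>

definition tree_set :: "('e \<Rightarrow> 'v set) \<Rightarrow> 'v set \<Rightarrow> 'e set \<Rightarrow> bool" where
  "tree_set en V T \<longleftrightarrow> finite V \<and> edge_set_on en V T \<and> card T + 1 = card V \<and> spans en V T"

text \<open>Only the red class \<open>R\<close> is stored; blue is \<open>E - R\<close>. The
  incidence map is a separate argument so that an edge can be re-attached by a function
  update.\<close>

definition factor :: "('e \<Rightarrow> 'v set) \<Rightarrow> 'v set \<Rightarrow> 'e set \<Rightarrow> 'e set \<Rightarrow> bool" where
  "factor en V E R \<longleftrightarrow> R \<subseteq> E \<and> tree_set en V R \<and> tree_set en V (E - R)"

definition incident :: "('e \<Rightarrow> 'v set) \<Rightarrow> 'e set \<Rightarrow> 'v \<Rightarrow> 'e set" where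
  "incident en E v = {e \<in> E. v \<in> en e}"

lemma closed_under_Compl: "closed_under en T X \<Longrightarrow> closed_under en T (- X)"
  unfolding closed_under_def by blast

lemma closed_underD: "closed_under en T X \<Longrightarrow> e \<in> T \<Longrightarrow> en e \<inter> X \<noteq> {} \<Longrightarrow> en e \<subseteq> X"
  unfolding closed_under_def by blast

lemma closed_under_edge:
  "closed_under en T X \<Longrightarrow> e \<in> T \<Longrightarrow> en e = {u, w} \<Longrightarrow> u \<in> X \<longleftrightarrow> w \<in> X"
  unfolding closed_under_def by blast

text \<open>A single root suffices because the complement of a closed set is closed.\<close>

lemma spansI:
  assumes "r \<in> V" and "\<And>X. closed_under en T X \<Longrightarrow> r \<in> X \<Longrightarrow> V \<subseteq> X"
  shows "spans en V T"
  unfolding spans_def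
proof (intro allI impI)
  fix X assume X: "closed_under en T X" "V \<inter> X \<noteq> {}"
  show "V \<subseteq> X"
  proof (cases "r \<in> X")
    case True then show ?thesis using assms(2) X by blast
  next
    case False
    then have "V \<subseteq> - X" using assms(2)[OF closed_under_Compl[OF X(1)]] by blast
    then show ?thesis using X(2) by blast
  qed
qed

lemma spansD: "spans en V T \<Longrightarrow> closed_under en T X \<Longrightarrow> r \<in> V \<Longrightarrow> r \<in> X \<Longrightarrow> V \<subseteq> X"
  unfolding spans_def by blast

lemma edge_set_on_other_end:
  assumes "edge_set_on en V T" "e \<in> T" "v \<in> en e"
  obtains w where "en e = {v, w}" "w \<noteq> v" "w \<in> V"
proof -
  have "card (en e) = 2" "en e \<subseteq> V" using assms unfolding edge_set_on_def by auto
  then obtain x y where xy: "en e = {x, y}" "x \<noteq> y" by (auto simp: card_2_iff)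
  show ?thesis
  proof (cases "v = x")
    case True then show ?thesis using that[of y] xy \<open>en e \<subseteq> V\<close> by auto
  next
    case False
    then have "v = y" using assms(3) xy by auto
    then show ?thesis using that[of x] xy \<open>en e \<subseteq> V\<close> by auto
  qed
qed

lemma tree_set_cong:
  assumes "\<And>e. e \<in> T \<Longrightarrow> en e = en' e"
  shows "tree_set en V T = tree_set en' V T"
  unfolding tree_set_def edge_set_on_def spans_def closed_under_def using assms by (simp cong: ball_cong)

lemma tree_set_fun_upd: "e \<notin> T \<Longrightarrow> tree_set (en(e := X)) V T = tree_set en V T"
  by (rule tree_set_cong) auto

lemma factor_Compl: "factor en V E R \<Longrightarrow> factor en V E (E - R)"
  unfolding factor_def by (simp add: double_diff)

section \<open>Trees under leaf insertion, leaf removal, subdivision and suppression\<close>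

lemma tree_set_leaf_insert:
  assumes T: "tree_set en V T" and "v \<notin> V" "e \<notin> T" "en e = {v, a}" "a \<in> V"
  shows "tree_set en (insert v V) (insert e T)"
proof -
  have "spans en (insert v V) (insert e T)"
  proof (rule spansI)
    show "a \<in> insert v V" using assms by simp
  next
    fix X assume X: "closed_under en (insert e T) X" "a \<in> X"
    then have "v \<in> X" using closed_under_edge[OF X(1)] assms(4) by blast
    moreover have "closed_under en T X" using X unfolding closed_under_def by blast
    ultimately show "insert v V \<subseteq> X" using spansD[of en V T X a] T X assms(5) unfolding tree_set_def by blast
  qed
  moreover have "v \<noteq> a" using assms by auto
  ultimately show ?thesis using assms unfolding tree_set_def edge_set_on_def by auto
qed

text \<open>A set containing \<open>a\<close> and closed under the smaller tree becomes closed in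
  the larger one once \<open>v\<close> is added, since \<open>e\<close> is the only edge at
  \<open>v\<close>.\<close>

lemma tree_set_leaf_remove:
  assumes T: "tree_set en (insert v V) T" and "v \<notin> V" "incident en T v = {e}" "en e = {v, a}" "a \<in> V"
  shows "tree_set en V (T - {e})"
proof -
  have e: "e \<in> T" using assms(3) unfolding incident_def by auto
  have nv: "v \<notin> en d" if "d \<in> T" "d \<noteq> e" for d using assms(3) that unfolding incident_def by auto
  have "spans en V (T - {e})"
  proof (rule spansI)
    show "a \<in> V" by fact
  next
    fix X assume X: "closed_under en (T - {e}) X" "a \<in> X"
    have "closed_under en T (insert v X)"
      using X nv assms(4) unfolding closed_under_def by auto
    then show "V \<subseteq> X" using spansD[of en "insert v V" T "insert v X" v] T \<open>v \<notin> V\<close> unfolding tree_set_def by blast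
  qed
  moreover have "card T = Suc (card (T - {e}))" using e T unfolding tree_set_def edge_set_on_def
    by (metis card.remove)
  ultimately show ?thesis using T nv \<open>v \<notin> V\<close> unfolding tree_set_def edge_set_on_def by auto
qed

text \<open>\<open>e\<close> keeps its name for the half at \<open>a\<close> and \<open>d\<close> is
  the half at \<open>b\<close>, so the edge set changes only by \<open>d\<close>. A closed set
  containing \<open>v\<close> contains both \<open>a\<close> and \<open>b\<close>, hence is closed
  for the undivided edge.\<close>

lemma tree_set_subdivide:
  assumes T: "tree_set en' V T" and v: "v \<notin> V"
    and e: "e \<in> T" "d \<notin> T" "en' e = {a, b}" "en e = {v, a}" "en d = {v, b}"
    and eq: "\<And>x. x \<in> T \<Longrightarrow> x \<noteq> e \<Longrightarrow> en x = en' x"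
  shows "tree_set en (insert v V) (insert d T)"
proof -
  have ab: "a \<in> V" "b \<in> V" using T e unfolding tree_set_def edge_set_on_def by auto
  have "spans en (insert v V) (insert d T)"
  proof (rule spansI)
    show "v \<in> insert v V" by simp
  next
    fix X assume X: "closed_under en (insert d T) X" "v \<in> X"
    then have "a \<in> X" "b \<in> X" using closed_under_edge[OF X(1)] e by blast+
    moreover have "closed_under en' T X"
      unfolding closed_under_def
    proof (intro ballI impI)
      fix x assume x: "x \<in> T" "en' x \<inter> X \<noteq> {}"
      show "en' x \<subseteq> X"
      proof (cases "x = e")
        case True then show ?thesis using e \<open>a \<in> X\<close> \<open>b \<in> X\<close> by auto
      next
        case False then show ?thesis
          using closed_underD[OF X(1), of x] x eq[OF x(1)] by simp
      qed
    qed
    ultimately show "insert v V \<subseteq> X" using spansD[of en' V T X a] T X ab unfolding tree_set_def by blast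
  qed
  moreover have "v \<noteq> a" "v \<noteq> b" using ab v by auto
  moreover have "en x \<subseteq> insert v V \<and> card (en x) = 2" if "x \<in> insert d T" for x
    using that e ab eq[of x] T \<open>v \<noteq> a\<close> \<open>v \<noteq> b\<close> unfolding tree_set_def edge_set_on_def
    by (cases "x = e"; cases "x = d") auto
  ultimately show ?thesis using T v e(2) unfolding tree_set_def edge_set_on_def by auto
qed

text \<open>Inverse of subdivision; \<open>a \<noteq> b\<close> keeps the merged edge from being a
  loop.\<close>

lemma tree_set_suppress:
  assumes T: "tree_set en (insert v V) T" and v: "v \<notin> V" and ab: "a \<in> V" "b \<in> V" "a \<noteq> b"
    and e: "incident en T v = {e, d}" "e \<noteq> d" "en' e = {a, b}" "en e = {v, a}" "en d = {v, b}"
    and eq: "\<And>x. x \<in> T \<Longrightarrow> x \<noteq> e \<Longrightarrow> en x = en' x"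
  shows "tree_set en' V (T - {d})"
proof -
  have ed: "e \<in> T" "d \<in> T" using e(1) unfolding incident_def by auto
  have nv: "v \<notin> en x" if "x \<in> T" "x \<noteq> e" "x \<noteq> d" for x using e(1) that unfolding incident_def by auto
  have "spans en' V (T - {d})"
  proof (rule spansI)
    show "a \<in> V" by fact
  next
    fix X assume X: "closed_under en' (T - {d}) X" "a \<in> X"
    then have "b \<in> X" using closed_under_edge[OF X(1), of e a b] ed e by blast
    have "closed_under en T (insert v X)"
      unfolding closed_under_def
    proof (intro ballI impI)
      fix x assume x: "x \<in> T" "en x \<inter> insert v X \<noteq> {}"
      show "en x \<subseteq> insert v X"
      proof (cases "x = e \<or> x = d")
        case True then show ?thesis using e \<open>a \<in> X\<close> \<open>b \<in> X\<close> by auto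
      next
        case False then show ?thesis
          using closed_underD[OF X(1), of x] x eq[OF x(1)] nv[OF x(1)] by auto
      qed
    qed
    then show "V \<subseteq> X" using spansD[of en "insert v V" T "insert v X" v] T v unfolding tree_set_def by blast
  qed
  moreover have "card T = Suc (card (T - {d}))" using ed T unfolding tree_set_def edge_set_on_def
    by (metis card.remove)
  moreover have "en' x \<subseteq> V \<and> card (en' x) = 2" if x: "x \<in> T - {d}" for x
  proof (cases "x = e")
    case True then show ?thesis using e ab by simp
  next
    case False
    then have "v \<notin> en x" "en x = en' x" using x eq[of x] nv[of x] by simp_all
    moreover have "en x \<subseteq> insert v V" "card (en x) = 2"
      using x T unfolding tree_set_def edge_set_on_def by blast+
    ultimately show ?thesis by auto
  qed
  ultimately show ?thesis using T v unfolding tree_set_def edge_set_on_def by auto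
qed

section \<open>Spanning subsets with as many edges as a tree, and minimality\<close>

lemma spanning_subset_of_card:
  assumes "finite V" "finite T" "V \<noteq> {}" "spans en V T" "edge_set_on en V T" "k \<ge> 1" "k \<le> card V"
  shows "\<exists>X S. X \<subseteq> V \<and> card X = k \<and> S \<subseteq> T \<and> card S + 1 = k \<and> (\<forall>e\<in>S. en e \<subseteq> X) \<and> spans en X S"
  using assms(6,7)
proof (induction k rule: dec_induct)
  case base
  obtain r where "r \<in> V" using assms by auto
  then show ?case by (intro exI[of _ "{r}"] exI[of _ "{}"]) (auto simp: spans_def)
next
  case (step k)
  then obtain X S where XS: "X \<subseteq> V" "card X = k" "S \<subseteq> T" "card S + 1 = k" "\<forall>e\<in>S. en e \<subseteq> X" "spans en X S"
    by auto
  have "X \<noteq> {}" using XS(2) step by auto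
  moreover have "\<not> V \<subseteq> X" using XS step card_mono[of X V] assms(1)
    by (metis Suc_n_not_le_n finite_subset order_trans)
  \<comment> \<open>Prim's growth step: as \<open>X\<close> is not yet all of \<open>V\<close>,
    connectedness supplies an edge leaving it, and its outer end is added.\<close>
  ultimately have "\<not> closed_under en T X" using assms(4) XS(1) unfolding spans_def by blast
  then obtain e where e: "e \<in> T" "en e \<inter> X \<noteq> {}" "\<not> en e \<subseteq> X" unfolding closed_under_def by blast
  then obtain u where u: "u \<in> en e" "u \<in> X" by blast
  obtain w where w: "en e = {u, w}" "w \<in> V" using edge_set_on_other_end[OF assms(5) e(1) u(1)] by metis
  have wX: "w \<notin> X" using e w u by auto
  have "e \<notin> S" using XS e by auto
  have fin: "finite X" "finite S" using XS assms finite_subset by blast+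
  have "spans en (insert w X) (insert e S)"
  proof (rule spansI[of w])
    fix Y assume Y: "closed_under en (insert e S) Y" "w \<in> Y"
    then have "u \<in> Y" using closed_under_edge[OF Y(1), of e u w] w by auto
    moreover have "closed_under en S Y" using Y unfolding closed_under_def by auto
    ultimately show "insert w X \<subseteq> Y" using spansD[OF XS(6)] u Y by blast
  qed simp
  then show ?case using XS wX w e u fin \<open>e \<notin> S\<close>
    by (intro exI[of _ "insert w X"] exI[of _ "insert e S"]) auto
qed

lemma spanning_subset:
  assumes "finite V" "V \<noteq> {}" "spans en V T" "edge_set_on en V T"
  obtains S where "S \<subseteq> T" "card S + 1 = card V" "spans en V S"
proof -
  have "finite T" using assms unfolding edge_set_on_def by auto
  have "card V \<ge> 1" using assms by (simp add: Suc_leI card_gt_0_iff)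
  from spanning_subset_of_card[OF assms(1) \<open>finite T\<close> assms(2-4) this order_refl]
  obtain X S where "X \<subseteq> V" "card X = card V" "S \<subseteq> T" "card S + 1 = card V" "spans en X S" by auto
  then show ?thesis using that assms(1) card_subset_eq by metis
qed

lemma tree_set_incident_nonempty:
  assumes T: "tree_set en V T" and "v \<in> V" "card V \<ge> 2"
  shows "incident en T v \<noteq> {}"
proof
  assume "incident en T v = {}"
  then have "closed_under en T {v}" unfolding closed_under_def incident_def by auto
  then have "V \<subseteq> {v}" using spansD[of en V T "{v}" v] T assms unfolding tree_set_def by auto
  then show False using assms(3) card_mono[of "{v}" V] by auto
qed

text \<open>Otherwise \<open>T - {e}\<close> would contain a spanning set of
  \<open>card V - 1\<close> edges, one more than it has.\<close>

lemma tree_set_minimal: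
  assumes T: "tree_set en V T" and e: "e \<in> T"
  shows "\<not> spans en V (T - {e})"
proof
  assume "spans en V (T - {e})"
  have fin: "finite T" using T unfolding tree_set_def edge_set_on_def by auto
  have "edge_set_on en V (T - {e})" using T unfolding tree_set_def edge_set_on_def by auto
  moreover have "V \<noteq> {}" "finite V" using T unfolding tree_set_def by auto
  ultimately obtain S where "S \<subseteq> T - {e}" "card S + 1 = card V"
    using spanning_subset \<open>spans en V (T - {e})\<close> by metis
  then have "card V \<le> card (T - {e}) + 1" using card_mono[of "T - {e}" S] fin by auto
  moreover have "card (T - {e}) < card T" using e fin by (meson card_Diff1_less)
  ultimately show False using T unfolding tree_set_def by auto
qed

text \<open>Deleting one of two parallel edges leaves the closed sets unchanged, against
  minimality.\<close>

lemma tree_set_no_parallel: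
  assumes T: "tree_set en V T" and e: "e \<in> T" "d \<in> T" "en e = en d"
  shows "e = d"
proof (rule ccontr)
  assume "e \<noteq> d"
  have "closed_under en T X" if "closed_under en (T - {e}) X" for X
    using that e \<open>e \<noteq> d\<close> unfolding closed_under_def by (metis DiffI singletonD)
  then have "spans en V (T - {e})" using T unfolding tree_set_def spans_def by blast
  then show False using tree_set_minimal[OF T e(1)] by simp
qed

section \<open>Factorizations around vertices of degree two and three\<close>

lemma factor_both_colours:
  assumes "factor en V E R" "v \<in> V" "card V \<ge> 2"
  shows "\<exists>e\<in>incident en E v. e \<in> R" "\<exists>e\<in>incident en E v. e \<notin> R"
proof -
  have "tree_set en V R" "tree_set en V (E - R)" "R \<subseteq> E" using assms(1) unfolding factor_def by auto
  moreover from this have "incident en R v \<noteq> {}" "incident en (E - R) v \<noteq> {}"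
    using tree_set_incident_nonempty[OF _ assms(2,3)] by auto
  ultimately show "\<exists>e\<in>incident en E v. e \<in> R" "\<exists>e\<in>incident en E v. e \<notin> R"
    unfolding incident_def by auto
qed

text \<open>\<open>v\<close> is a leaf of both trees, because its two edges have different
  colours.\<close>

lemma factor_delete:
  assumes R: "factor en V E R" and v: "v \<in> V" and inc: "incident en E v = {d, e}"
    and ends: "en d = {v, a}" "en e = {v, b}" "a \<in> V - {v}" "b \<in> V - {v}"
    and col: "d \<in> R" "e \<notin> R"
  shows "factor en (V - {v}) (E - {d, e}) (R - {d, e})"
proof -
  have RE: "R \<subseteq> E" using R unfolding factor_def by auto
  have ins: "insert v (V - {v}) = V" using v by auto
  have "incident en R v = {d}" "incident en (E - R) v = {e}"
    using inc col RE unfolding incident_def by auto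
  moreover have "tree_set en (insert v (V - {v})) R" "tree_set en (insert v (V - {v})) (E - R)"
    using R ins unfolding factor_def by auto
  ultimately have "tree_set en (V - {v}) (R - {d})" "tree_set en (V - {v}) (E - R - {e})"
    using tree_set_leaf_remove[of en v "V - {v}"] ends by blast+
  moreover have "R - {d, e} = R - {d}" "E - {d, e} - (R - {d, e}) = E - R - {e}" using col by auto
  ultimately show ?thesis using RE unfolding factor_def by auto
qed

lemma factor_insert:
  assumes R: "factor en (V - {v}) (E - {d, e}) R" and v: "v \<in> V" and inc: "incident en E v = {d, e}" "d \<noteq> e"
    and ends: "en d = {v, a}" "en e = {v, b}" "a \<in> V - {v}" "b \<in> V - {v}"
  shows "factor en V E (insert d R)"
proof -
  have ins: "insert v (V - {v}) = V" using v by auto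
  have de: "d \<in> E" "e \<in> E" using inc unfolding incident_def by auto
  have R': "R \<subseteq> E - {d, e}" using R unfolding factor_def by auto
  have "tree_set en (insert v (V - {v})) (insert d R)"
    by (rule tree_set_leaf_insert[of _ _ _ _ _ a]) (use R R' ends in \<open>auto simp: factor_def\<close>)
  moreover have "tree_set en (insert v (V - {v})) (insert e (E - {d, e} - R))"
    by (rule tree_set_leaf_insert[of _ _ _ _ _ b]) (use R R' ends in \<open>auto simp: factor_def\<close>)
  moreover have "E - insert d R = insert e (E - {d, e} - R)" using R' de inc(2) by auto
  ultimately show ?thesis using R' de ins unfolding factor_def by auto
qed

section \<open>Vertices of degree three: merging two edges and exchanging colours\<close>

definition cubic :: "('e \<Rightarrow> 'v set) \<Rightarrow> 'v set \<Rightarrow> 'e set \<Rightarrow> 'v \<Rightarrow> 'e \<Rightarrow> 'v \<Rightarrow> 'e \<Rightarrow> 'v \<Rightarrow> 'e \<Rightarrow> 'v \<Rightarrow> bool" where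
  "cubic en V E v e1 a e2 b e3 c \<longleftrightarrow> v \<in> V \<and> incident en E v = {e1, e2, e3} \<and>
     e1 \<noteq> e2 \<and> e1 \<noteq> e3 \<and> e2 \<noteq> e3 \<and> en e1 = {v, a} \<and> en e2 = {v, b} \<and> en e3 = {v, c} \<and>
     a \<in> V - {v} \<and> b \<in> V - {v} \<and> c \<in> V - {v}"

lemma cubic_swap12: "cubic en V E v e1 a e2 b e3 c \<Longrightarrow> cubic en V E v e2 b e1 a e3 c"
  and cubic_swap13: "cubic en V E v e1 a e2 b e3 c \<Longrightarrow> cubic en V E v e3 c e2 b e1 a"
  and cubic_swap23: "cubic en V E v e1 a e2 b e3 c \<Longrightarrow> cubic en V E v e1 a e3 c e2 b"
  unfolding cubic_def by auto

lemma cubic_edges: "cubic en V E v e1 a e2 b e3 c \<Longrightarrow> e1 \<in> E \<and> e2 \<in> E \<and> e3 \<in> E"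
  unfolding cubic_def incident_def by auto

lemma cubic_card: "cubic en V E v e1 a e2 b e3 c \<Longrightarrow> finite V \<Longrightarrow> card V \<ge> 2"
  unfolding cubic_def using card_mono[of V "{v, a}"] by auto

text \<open>Both colours occur at \<open>v\<close>, so \<open>e3\<close> is blue, \<open>v\<close>
  is a blue leaf, and the red path \<open>a\<close>, \<open>v\<close>, \<open>b\<close> contracts to
  the re-attached \<open>e1\<close>. Coinciding neighbours are allowed by \<open>cubic\<close>, but
  \<open>a = b\<close> would put two parallel edges into the red tree.\<close>

lemma factor_merge:
  assumes cub: "cubic en V E v e1 a e2 b e3 c" and R: "factor en V E R" and col: "e1 \<in> R" "e2 \<in> R"
  shows "e3 \<notin> R" "a \<noteq> b" "factor (en(e1 := {a, b})) (V - {v}) (E - {e2, e3}) (R - {e2})"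
proof -
  have fin: "finite V" using R unfolding factor_def tree_set_def by auto
  have inc: "incident en E v = {e1, e2, e3}" using cub unfolding cubic_def by auto
  show e3: "e3 \<notin> R"
    using factor_both_colours(2)[OF R _ cubic_card[OF cub fin], of v] cub col inc unfolding cubic_def by auto
  show ab: "a \<noteq> b"
    using tree_set_no_parallel[of en V R e1 e2] R cub col unfolding factor_def cubic_def by auto
  have RE: "R \<subseteq> E" using R unfolding factor_def by auto
  have ins: "insert v (V - {v}) = V" using cub unfolding cubic_def by auto
  have iR: "incident en R v = {e1, e2}" and iB: "incident en (E - R) v = {e3}"
    using inc col e3 RE unfolding incident_def by auto
  have tR: "tree_set en (insert v (V - {v})) R" and tB: "tree_set en (insert v (V - {v})) (E - R)"
    using R ins unfolding factor_def by auto
  have "tree_set (en(e1 := {a, b})) (V - {v}) (R - {e2})"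
    using tree_set_suppress[OF tR _ _ _ ab iR, of "en(e1 := {a, b})"] cub unfolding cubic_def by auto
  moreover have "tree_set en (V - {v}) (E - R - {e3})"
    using tree_set_leaf_remove[OF tB _ iB] cub unfolding cubic_def by auto
  then have "tree_set (en(e1 := {a, b})) (V - {v}) (E - R - {e3})"
    using col by (simp add: tree_set_fun_upd)
  moreover have "E - {e2, e3} - (R - {e2}) = E - R - {e3}" using col by auto
  ultimately show "factor (en(e1 := {a, b})) (V - {v}) (E - {e2, e3}) (R - {e2})"
    using RE e3 unfolding factor_def by auto
qed

text \<open>\<open>e2\<close> takes the colour of \<open>e1\<close> and \<open>e3\<close> the other
  one, so exactly one of \<open>e2\<close>, \<open>e3\<close> joins the red class.\<close>

lemma factor_unmerge:
  assumes cub: "cubic en V E v e1 a e2 b e3 c"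
    and R: "factor (en(e1 := {a, b})) (V - {v}) (E - {e2, e3}) R"
  shows "factor en V E (insert (if e1 \<in> R then e2 else e3) R)"
proof -
  have ins: "insert v (V - {v}) = V" using cub unfolding cubic_def by auto
  have eE: "e1 \<in> E" "e2 \<in> E" "e3 \<in> E" using cubic_edges[OF cub] by auto
  have red: "factor en V E (insert e2 S)"
    if S: "factor (en(e1 := {a, b})) (V - {v}) (E - {e2, e3}) S" and e1: "e1 \<in> S" for S
  proof -
    have SE: "S \<subseteq> E - {e2, e3}" using S unfolding factor_def by auto
    have t: "tree_set (en(e1 := {a, b})) (V - {v}) S" 
      and t': "tree_set (en(e1 := {a, b})) (V - {v}) (E - {e2, e3} - S)"
      using S unfolding factor_def by auto
    have "tree_set en (insert v (V - {v})) (insert e2 S)"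
      by (rule tree_set_subdivide[OF t, of v e1 e2 a b]) (use cub e1 SE in \<open>auto simp: cubic_def\<close>)
    moreover have "tree_set en (V - {v}) (E - {e2, e3} - S)"
      using t' e1 by (simp add: tree_set_fun_upd)
    then have "tree_set en (insert v (V - {v})) (insert e3 (E - {e2, e3} - S))"
      by (rule tree_set_leaf_insert[of _ _ _ _ _ c]) (use cub in \<open>auto simp: cubic_def\<close>)
    moreover have "E - insert e2 S = insert e3 (E - {e2, e3} - S)"
      using SE eE cub unfolding cubic_def by auto
    ultimately show ?thesis using SE eE ins unfolding factor_def by auto
  qed
  show ?thesis
  proof (cases "e1 \<in> R")
    case True then show ?thesis using red R by auto
  next
    case False
    \<comment> \<open>With \<open>e1\<close> blue, the red case is applied to the complementary
      factorization: blue gains \<open>e2\<close>, so red gains \<open>e3\<close>.\<close>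
    have RE: "R \<subseteq> E - {e2, e3}" using R unfolding factor_def by auto
    have "e1 \<in> E - {e2, e3} - R" using False eE cub unfolding cubic_def by auto
    from factor_Compl[OF red[OF factor_Compl[OF R] this]]
    have "factor en V E (E - insert e2 (E - {e2, e3} - R))" .
    moreover have "E - insert e2 (E - {e2, e3} - R) = insert e3 R"
      using RE eE cub unfolding cubic_def by auto
    ultimately show ?thesis using False by auto
  qed
qed

text \<open>\<open>e3\<close> is a leaf edge of the blue tree at \<open>v\<close>, so either red
  edge at \<open>v\<close> can replace it there. Adding \<open>e3\<close> to the red tree closes a
  cycle through \<open>v\<close> that uses exactly one of \<open>e1\<close>, \<open>e2\<close>; that
  one is removed. The proof uses cuts instead of the cycle.\<close>

lemma factor_exchange:
  assumes cub: "cubic en V E v e1 a e2 b e3 c" and R: "factor en V E R" and col: "e1 \<in> R" "e2 \<in> R"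
  shows "factor en V E (insert e3 (R - {e1})) \<or> factor en V E (insert e3 (R - {e2}))"
proof -
  have e3: "e3 \<notin> R" using factor_merge(1)[OF cub R col] .
  have RE: "R \<subseteq> E" and tR: "tree_set en V R" and tB: "tree_set en V (E - R)" using R unfolding factor_def by auto
  have inc: "incident en E v = {e1, e2, e3}" using cub unfolding cubic_def by auto
  have eE: "e1 \<in> E" "e2 \<in> E" "e3 \<in> E" using cubic_edges[OF cub] by auto
  have ins: "insert v (V - {v}) = V" using cub unfolding cubic_def by auto
  have finR: "finite R" and on: "edge_set_on en V R" "edge_set_on en V (E - R)"
    using tR tB unfolding tree_set_def edge_set_on_def by auto
  have blue: "tree_set en V (E - insert e3 (R - {e}))" if e: "e = e1 \<or> e = e2" for e
  proof -
    have "incident en (E - R) v = {e3}" using inc col e3 unfolding incident_def by auto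
    then have "tree_set en (V - {v}) (E - R - {e3})"
      by (intro tree_set_leaf_remove[of en v "V - {v}" "E - R" e3 c])
        (use tB ins cub in \<open>simp_all add: cubic_def\<close>)
    moreover obtain x where "en e = {v, x}" "x \<in> V - {v}" using cub e unfolding cubic_def by metis
    ultimately have "tree_set en (insert v (V - {v})) (insert e (E - R - {e3}))"
      by (intro tree_set_leaf_insert[of en "V - {v}" "E - R - {e3}" v e x]) (use e col in auto)
    moreover have "E - insert e3 (R - {e}) = insert e (E - R - {e3})" using e col e3 eE by auto
    ultimately show ?thesis using ins by simp
  qed
  have red: "factor en V E (insert e3 (R - {e}))" if e: "e = e1 \<or> e = e2" and "spans en V (insert e3 (R - {e}))" for e
  proof -
    have "e \<in> R" using e col by auto
    then have "card R = Suc (card (R - {e}))" using finR by (metis card.remove)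
    then have "card (insert e3 (R - {e})) = card R" using e3 finR by simp
    moreover have "edge_set_on en V (insert e3 (R - {e}))" using on e3 eE unfolding edge_set_on_def by auto
    ultimately have "tree_set en V (insert e3 (R - {e}))" using tR that(2) unfolding tree_set_def by auto
    then show ?thesis using blue[OF e] RE eE unfolding factor_def by auto
  qed
  \<comment> \<open>The blue class and the edge count are right for both exchanges, so a failing one
    leaves the red set disconnected.\<close>
  have cut: "\<exists>X. closed_under en (insert e3 (R - {e})) X \<and> v \<in> X \<and> \<not> V \<subseteq> X"
    if "e = e1 \<or> e = e2" "\<not> factor en V E (insert e3 (R - {e}))" for e
    using red[OF that(1)] that(2) spansI[of v V en "insert e3 (R - {e})"] cub unfolding cubic_def by blast
  show ?thesis
  proof (rule ccontr)
    assume "\<not> ?thesis"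
    then obtain X Y where X: "closed_under en (insert e3 (R - {e1})) X" "v \<in> X" "\<not> V \<subseteq> X"
      and Y: "closed_under en (insert e3 (R - {e2})) Y" "v \<in> Y" "\<not> V \<subseteq> Y"
      using cut[of e1] cut[of e2] by blast
    have ends: "en e1 = {v, a}" "en e2 = {v, b}" "en e3 = {v, c}" "v \<noteq> a" "v \<noteq> b" "v \<noteq> c" "v \<in> V" "c \<in> V"
      "e1 \<noteq> e2"
      using cub unfolding cubic_def by auto
    have c: "c \<in> X \<inter> Y" using X Y closed_under_edge[of en _ _ e3 v c] ends by blast
    have "a \<notin> X"
    proof
      assume "a \<in> X"
      then have "closed_under en R X" using X ends unfolding closed_under_def by auto
      then show False using spansD[of en V R X v] tR X ends unfolding tree_set_def by auto
    qed
    have "b \<notin> Y"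
    proof
      assume "b \<in> Y"
      then have "closed_under en R Y" using Y ends unfolding closed_under_def by auto
      then show False using spansD[of en V R Y v] tR Y ends unfolding tree_set_def by auto
    qed
    \<comment> \<open>\<open>e1\<close> runs from \<open>v\<close> out of \<open>X\<close> and
      \<open>e2\<close> from \<open>v\<close> out of \<open>Y\<close>, so neither meets
      \<open>X \<inter> Y - {v}\<close>. This set would then separate \<open>c\<close> from
      \<open>v\<close> in the red tree.\<close>
    have "closed_under en R (X \<inter> Y - {v})"
      unfolding closed_under_def
    proof (intro ballI impI)
      fix x assume x: "x \<in> R" "en x \<inter> (X \<inter> Y - {v}) \<noteq> {}"
      then have n: "x \<noteq> e1" "x \<noteq> e2" using ends \<open>a \<notin> X\<close> \<open>b \<notin> Y\<close> by auto
      then have "v \<notin> en x" using inc x RE e3 unfolding incident_def by auto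
      moreover have "en x \<subseteq> X" using closed_underD[OF X(1), of x] x n by auto
      moreover have "en x \<subseteq> Y" using closed_underD[OF Y(1), of x] x n by auto
      ultimately show "en x \<subseteq> X \<inter> Y - {v}" by auto
    qed
    then show False using spansD[of en V R "X \<inter> Y - {v}" c] tR c ends unfolding tree_set_def by auto
  qed
qed

section \<open>Discrepancy and links\<close>

definition disc :: "'e set \<Rightarrow> 'e set \<Rightarrow> int" where
  "disc R S = (\<Sum>e\<in>S. if e \<in> R then 1 else - 1)"

text \<open>For signs 1 and -1 this is out-degree minus in-degree at \<open>u\<close> in the
  multigraph of links, where \<open>\<sigma> i\<close> orients link \<open>i\<close> between
  \<open>f i\<close> and \<open>g i\<close>. A link with equal ends contributes 0.\<close>

definition flow :: "'i set \<Rightarrow> ('i \<Rightarrow> 'v) \<Rightarrow> ('i \<Rightarrow> 'v) \<Rightarrow> ('i \<Rightarrow> int) \<Rightarrow> 'v \<Rightarrow> int" where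
  "flow I f g \<sigma> u = (\<Sum>i\<in>I. \<sigma> i * (of_bool (u = f i) - of_bool (u = g i)))"

lemma disc_cong: "(\<And>e. e \<in> S \<Longrightarrow> e \<in> R \<longleftrightarrow> e \<in> R') \<Longrightarrow> disc R S = disc R' S"
  unfolding disc_def by (intro sum.cong) auto

lemma disc_empty [simp]: "disc R {} = 0"
  unfolding disc_def by simp

lemma disc_insert: "finite S \<Longrightarrow> e \<notin> S \<Longrightarrow> disc R (insert e S) = (if e \<in> R then 1 else - 1) + disc R S"
  unfolding disc_def by simp

lemma disc_eq_card:
  assumes "finite S"
  shows "disc R S = int (card (S \<inter> R)) - int (card (S - R))"
  using assms
proof (induction S rule: finite_induct)
  case (insert e S)
  then show ?case
    by (cases "e \<in> R") (simp_all add: disc_insert insert_Diff_if)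
qed simp

lemma flow_eq_0: "(\<And>i. i \<in> I \<Longrightarrow> f i \<noteq> u \<and> g i \<noteq> u) \<Longrightarrow> flow I f g \<sigma> u = 0"
  unfolding flow_def by (intro sum.neutral) auto

lemma flow_cong: "(\<And>i. i \<in> I \<Longrightarrow> f i = f' i \<and> g i = g' i) \<Longrightarrow> flow I f g \<sigma> u = flow I f' g' \<sigma> u"
  unfolding flow_def by (intro sum.cong) auto

text \<open>Two edges at a common vertex are replaced by a single one bypassing that vertex, and
  receive signs under which they cancel there.\<close>

lemma balanced_signs:
  assumes "finite I"
  shows "\<exists>\<sigma>. (\<forall>i. \<sigma> i = 1 \<or> \<sigma> i = - 1) \<and> (\<forall>u. \<bar>flow I f g \<sigma> u\<bar> \<le> 1)"
  using assms
proof (induction "card I" arbitrary: I f g)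
  case 0
  then show ?case by (intro exI[of _ "\<lambda>_. 1"]) (simp add: flow_def)
next
  case (Suc n)
  show ?case
  proof (cases "\<exists>i\<in>I. \<exists>j\<in>I. i \<noteq> j \<and> {f i, g i} \<inter> {f j, g j} \<noteq> {}")
    case True
    then obtain i j where ij: "i \<in> I" "j \<in> I" "i \<noteq> j" "{f i, g i} \<inter> {f j, g j} \<noteq> {}" by blast
    \<comment> \<open>\<tau> is chosen so that the contributions at the shared end cancel; what
      remains is again a single link, from \<open>x\<close> to \<open>y\<close>.\<close>
    have "\<exists>x y \<tau>. (\<tau> = 1 \<or> \<tau> = - 1) \<and> (\<forall>u. of_bool (u = x) - of_bool (u = y) =
        (of_bool (u = f i) - of_bool (u = g i)) + \<tau> * (of_bool (u = f j) - of_bool (u = g j) :: int))"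
    proof -
      consider "f i = f j" | "f i = g j" | "g i = f j" | "g i = g j" using ij(4) by auto
      then show ?thesis
      proof cases
        case 1 then show ?thesis by (intro exI[of _ "g j"] exI[of _ "g i"] exI[of _ "- 1"]) auto
      next
        case 2 then show ?thesis by (intro exI[of _ "f j"] exI[of _ "g i"] exI[of _ "1"]) auto
      next
        case 3 then show ?thesis by (intro exI[of _ "f i"] exI[of _ "g j"] exI[of _ "1"]) auto
      next
        case 4 then show ?thesis by (intro exI[of _ "f i"] exI[of _ "f j"] exI[of _ "- 1"]) auto
      qed
    qed
    then obtain x y \<tau> where \<tau>: "\<tau> = 1 \<or> \<tau> = - 1"
      and xy: "\<And>u. of_bool (u = x) - of_bool (u = y) =
        (of_bool (u = f i) - of_bool (u = g i)) + \<tau> * (of_bool (u = f j) - of_bool (u = g j) :: int)"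
      by blast
    \<comment> \<open>Index \<open>i\<close> now carries the combined link and \<open>j\<close> is
      removed; afterwards \<open>j\<close> gets the sign of \<open>i\<close> times \<tau>.\<close>
    have "n = card (I - {j})" "finite (I - {j})" using Suc ij by auto
    from Suc.hyps(1)[OF this, of "f(i := x)" "g(i := y)"]
    obtain \<sigma> where \<sigma>: "\<forall>i. \<sigma> i = 1 \<or> \<sigma> i = - 1" "\<forall>u. \<bar>flow (I - {j}) (f(i := x)) (g(i := y)) \<sigma> u\<bar> \<le> 1"
      by blast
    let ?\<sigma> = "\<sigma>(j := \<tau> * \<sigma> i)"
    have "flow I f g ?\<sigma> u = flow (I - {j}) (f(i := x)) (g(i := y)) \<sigma> u" for u
    proof -
      let ?t = "\<lambda>k. \<sigma> k * (of_bool (u = f k) - of_bool (u = g k))"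
      have I: "I = insert j (insert i (I - {i, j}))" "I - {j} = insert i (I - {i, j})" using ij by auto
      have fin: "finite (I - {i, j})" using Suc by auto
      have "flow I f g ?\<sigma> u = \<tau> * \<sigma> i * (of_bool (u = f j) - of_bool (u = g j)) + (?t i + (\<Sum>k\<in>I - {i, j}. ?t k))"
        unfolding flow_def by (subst I(1)) (use ij fin in \<open>auto intro!: sum.cong\<close>)
      also have "\<dots> = \<sigma> i * (of_bool (u = x) - of_bool (u = y)) + (\<Sum>k\<in>I - {i, j}. ?t k)"
        unfolding xy by (simp add: algebra_simps)
      also have "\<dots> = flow (I - {j}) (f(i := x)) (g(i := y)) \<sigma> u"
        unfolding flow_def by (subst I(2)) (use ij fin in \<open>auto intro!: sum.cong\<close>)
      finally show ?thesis .
    qed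
    then show ?thesis using \<sigma> \<tau> by (intro exI[of _ ?\<sigma>]) auto
  next
    case False
    \<comment> \<open>No two links share an end, so at most one contributes at
      \<open>u\<close>.\<close>
    have "\<bar>flow I f g (\<lambda>_. 1) u\<bar> \<le> 1" for u
    proof (cases "\<exists>i\<in>I. u \<in> {f i, g i}")
      case True
      then obtain i where i: "i \<in> I" "u \<in> {f i, g i}" by blast
      have "flow (I - {i}) f g (\<lambda>_. 1) u = 0" using False i by (intro flow_eq_0) blast
      then have "flow I f g (\<lambda>_. 1) u = of_bool (u = f i) - of_bool (u = g i)"
        unfolding flow_def using i Suc.prems by (simp add: sum.remove[of I i])
      then show ?thesis by auto
    next
      case False
      then have "flow I f g (\<lambda>_. 1) u = 0" by (intro flow_eq_0) blast
      then show ?thesis by simp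
    qed
    then show ?thesis by (intro exI[of _ "\<lambda>_. 1"]) simp
  qed
qed

text \<open>The conclusion quantifies over all sign choices for the links so that later links do not
  spoil the balance between earlier ones; the links are indexed by edges only to have fresh indices.\<close>

definition balanceable :: "('e \<Rightarrow> 'v set) \<Rightarrow> 'v set \<Rightarrow> 'e set \<Rightarrow> ('v \<Rightarrow> 'e set) \<Rightarrow> bool" where
  "balanceable en V E H \<longleftrightarrow> (\<exists>I f g. I \<subseteq> E \<and> (\<forall>i\<in>I. H (f i) \<noteq> {} \<and> H (g i) \<noteq> {}) \<and>
     (\<forall>\<sigma>. (\<forall>i. \<sigma> i = 1 \<or> \<sigma> i = - 1) \<longrightarrow>
       (\<exists>R. factor en V E R \<and> (\<forall>u\<in>V. \<bar>disc R (H u) - flow I f g \<sigma> u\<bar> \<le> 4))))"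

section \<open>Carrying balanceability back through the reductions\<close>

lemma balanceableI:
  assumes "I \<subseteq> E" "\<forall>i\<in>I. H (f i) \<noteq> {} \<and> H (g i) \<noteq> {}"
    and "\<And>\<sigma>. (\<forall>i. \<sigma> i = 1 \<or> \<sigma> i = - 1) \<Longrightarrow>
      \<exists>R. factor en V E R \<and> (\<forall>u\<in>V. \<bar>disc R (H u) - flow I f g \<sigma> u\<bar> \<le> 4)"
  shows "balanceable en V E H"
  unfolding balanceable_def using assms by blast

text \<open>At degree at most 5 both colours occur, so each has at most 4 edges and the bound 4
  holds for every choice of flags. Links end only at flagged vertices, so the flow is 0 where flags
  were dropped.\<close>

lemma balanceable_drop:
  fixes en :: "'e \<Rightarrow> 'v set"
  assumes "finite E" "card V \<ge> 2" "\<And>u. H u \<subseteq> incident en E u"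
    and bal: "balanceable en V E (\<lambda>u. if card (incident en E u) \<le> 5 then {} else H u)"
  shows "balanceable en V E H"
proof -
  let ?H = "\<lambda>u. if card (incident en E u) \<le> 5 then {} else H u"
  from bal obtain I f g where I: "I \<subseteq> E" "\<forall>i\<in>I. ?H (f i) \<noteq> {} \<and> ?H (g i) \<noteq> {}"
    and R: "\<And>\<sigma>. (\<forall>i. \<sigma> i = 1 \<or> \<sigma> i = - 1) \<Longrightarrow>
       (\<exists>R. factor en V E R \<and> (\<forall>u\<in>V. \<bar>disc R (?H u) - flow I f g \<sigma> u\<bar> \<le> 4))"
    unfolding balanceable_def by auto
  have small: "\<bar>disc R (H u) - flow I f g \<sigma> u\<bar> \<le> 4"
    if R: "factor en V E R" and u: "u \<in> V" "card (incident en E u) \<le> 5" for R u \<sigma>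
  proof -
    have "flow I f g \<sigma> u = 0" using I u by (intro flow_eq_0) auto
    moreover have fin: "finite (incident en E u)" using assms(1) unfolding incident_def by auto
    obtain x y where xy: "x \<in> incident en E u" "x \<in> R" "y \<in> incident en E u" "y \<notin> R"
      using factor_both_colours[OF R u(1) assms(2)] by auto
    have "H u \<inter> R \<subseteq> incident en E u - {y}" "H u - R \<subseteq> incident en E u - {x}" using assms(3) xy by auto
    then have "card (H u \<inter> R) \<le> card (incident en E u - {y})" "card (H u - R) \<le> card (incident en E u - {x})"
      using fin by (auto intro!: card_mono)
    then have "card (H u \<inter> R) \<le> 4" "card (H u - R) \<le> 4" using xy fin u(2) by auto
    then have "\<bar>disc R (H u)\<bar> \<le> 4" using disc_eq_card[of "H u" R] finite_subset[OF assms(3) fin] by linarith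
    ultimately show ?thesis by simp
  qed
  show ?thesis
  proof (rule balanceableI[of I _ _ f g])
    show "I \<subseteq> E" by fact
    show "\<forall>i\<in>I. H (f i) \<noteq> {} \<and> H (g i) \<noteq> {}" using I(2) by (metis (full_types))
    fix \<sigma> :: "'e \<Rightarrow> int" assume "\<forall>i. \<sigma> i = 1 \<or> \<sigma> i = - 1"
    from R[OF this] obtain R where R: "factor en V E R" "\<And>u. u \<in> V \<Longrightarrow> \<bar>disc R (?H u) - flow I f g \<sigma> u\<bar> \<le> 4"
      by auto
    have "\<bar>disc R (H u) - flow I f g \<sigma> u\<bar> \<le> 4" if "u \<in> V" for u
      using R(2)[OF that] small[OF R(1) that] by (cases "card (incident en E u) \<le> 5") auto
    then show "\<exists>R. factor en V E R \<and> (\<forall>u\<in>V. \<bar>disc R (H u) - flow I f g \<sigma> u\<bar> \<le> 4)" using R(1) by auto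
  qed
qed

text \<open>The sign of a new link between \<open>a\<close> and \<open>b\<close> decides which of
  \<open>d\<close>, \<open>e\<close> is red. As \<open>d\<close> counts only at \<open>a\<close> and
  \<open>e\<close> only at \<open>b\<close>, the discrepancy changes by exactly the flow of this
  link, also when \<open>a = b\<close>, so the bound 4 is kept.\<close>

lemma balanceable_link:
  fixes en :: "'e \<Rightarrow> 'v set"
  assumes bal: "balanceable en' (V - {v}) (E - {d, e}) (\<lambda>u. H u - {d, e})"
    and H: "\<And>u. H u \<subseteq> E" "H v = {}" and fin: "finite E" and de: "d \<in> E" "e \<in> E" "d \<noteq> e"
    and flag: "\<And>u. d \<in> H u \<longleftrightarrow> u = a" "\<And>u. e \<in> H u \<longleftrightarrow> u = b"
    and ext: "\<And>R. factor en' (V - {v}) (E - {d, e}) R \<Longrightarrow> factor en V E (insert d R) \<and> factor en V E (insert e R)"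
  shows "balanceable en V E H"
proof -
  let ?H = "\<lambda>u. H u - {d, e}"
  from bal obtain I f g where I: "I \<subseteq> E - {d, e}" "\<forall>i\<in>I. ?H (f i) \<noteq> {} \<and> ?H (g i) \<noteq> {}"
    and R: "\<And>\<sigma>. (\<forall>i. \<sigma> i = 1 \<or> \<sigma> i = - 1) \<Longrightarrow>
       (\<exists>R. factor en' (V - {v}) (E - {d, e}) R \<and> (\<forall>u\<in>V - {v}. \<bar>disc R (?H u) - flow I f g \<sigma> u\<bar> \<le> 4))"
    unfolding balanceable_def by auto
  \<comment> \<open>\<open>I\<close> avoids \<open>d\<close>, so \<open>d\<close> is free to index
    the new link.\<close>
  let ?I = "insert d I" and ?f = "f(d := a)" and ?g = "g(d := b)"
  have dI: "d \<notin> I" "finite I" using I(1) finite_subset[OF I(1)] fin by auto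
  have flagged: "\<forall>i\<in>?I. H (?f i) \<noteq> {} \<and> H (?g i) \<noteq> {}" using I(2) flag dI by auto
  show ?thesis
  proof (rule balanceableI[of ?I _ _ ?f ?g])
    show "?I \<subseteq> E" using I de by auto
    show "\<forall>i\<in>?I. H (?f i) \<noteq> {} \<and> H (?g i) \<noteq> {}" by fact
    fix \<sigma> :: "'e \<Rightarrow> int" assume \<sigma>: "\<forall>i. \<sigma> i = 1 \<or> \<sigma> i = - 1"
    from R[OF \<sigma>] obtain R where R: "factor en' (V - {v}) (E - {d, e}) R"
      "\<And>u. u \<in> V - {v} \<Longrightarrow> \<bar>disc R (?H u) - flow I f g \<sigma> u\<bar> \<le> 4"
      by auto
    have RE: "R \<subseteq> E - {d, e}" using R unfolding factor_def by auto
    let ?R = "if \<sigma> d = 1 then insert d R else insert e R"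
    have "\<bar>disc ?R (H u) - flow ?I ?f ?g \<sigma> u\<bar> \<le> 4" if u: "u \<in> V" for u
    proof (cases "u = v")
      case True
      \<comment> \<open>No link ends at \<open>v\<close>, as \<open>v\<close> carries no
        flag.\<close>
      have "flow ?I ?f ?g \<sigma> v = 0" using flagged H(2) by (intro flow_eq_0) metis
      then show ?thesis using True H(2) by simp
    next
      case False
      have "flow ?I ?f ?g \<sigma> u = \<sigma> d * (of_bool (u = a) - of_bool (u = b)) + flow I ?f ?g \<sigma> u"
        using dI unfolding flow_def by simp
      also have "flow I ?f ?g \<sigma> u = flow I f g \<sigma> u" using dI by (intro flow_cong) auto
      finally have fl: "flow ?I ?f ?g \<sigma> u = \<sigma> d * (of_bool (u = a) - of_bool (u = b)) + flow I f g \<sigma> u" .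
      have finH: "finite (?H u)" using H(1) fin finite_subset by blast
      have base: "disc ?R (?H u) = disc R (?H u)" by (intro disc_cong) auto
      have split: "H u = (if u = a then {d} else {}) \<union> ((if u = b then {e} else {}) \<union> ?H u)"
        using flag[of u] by auto
      have "disc ?R (H u) = \<sigma> d * (of_bool (u = a) - of_bool (u = b)) + disc R (?H u)"
        using \<sigma>[rule_format, of d] finH de(3) RE
        by (subst split) (auto simp: disc_insert base[symmetric])
      then show ?thesis using R(2)[of u] u False fl by simp
    qed
    moreover have "factor en V E ?R" using ext[OF R(1)] by auto
    ultimately show "\<exists>R. factor en V E R \<and> (\<forall>u\<in>V. \<bar>disc R (H u) - flow ?I ?f ?g \<sigma> u\<bar> \<le> 4)" by blast
  qed
qed

text \<open>Only \<open>d\<close> may count, and only at \<open>a\<close>. Its colour is free and is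
  chosen against the sign of the current error there, which keeps that error within 4.\<close>

lemma balanceable_one_sided:
  fixes en :: "'e \<Rightarrow> 'v set"
  assumes bal: "balanceable en' (V - {v}) (E - {d, e}) (\<lambda>u. H u - {d, e})"
    and H: "\<And>u. H u \<subseteq> E" "H v = {}" and fin: "finite E" and de: "d \<in> E" "e \<in> E" "d \<noteq> e"
    and flag: "\<And>u. d \<in> H u \<Longrightarrow> u = a" "\<And>u. e \<notin> H u"
    and ext: "\<And>R. factor en' (V - {v}) (E - {d, e}) R \<Longrightarrow> factor en V E (insert d R) \<and> factor en V E (insert e R)"
  shows "balanceable en V E H"
proof -
  let ?H = "\<lambda>u. H u - {d, e}"
  from bal obtain I f g where I: "I \<subseteq> E - {d, e}" "\<forall>i\<in>I. ?H (f i) \<noteq> {} \<and> ?H (g i) \<noteq> {}"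
    and R: "\<And>\<sigma>. (\<forall>i. \<sigma> i = 1 \<or> \<sigma> i = - 1) \<Longrightarrow>
       (\<exists>R. factor en' (V - {v}) (E - {d, e}) R \<and> (\<forall>u\<in>V - {v}. \<bar>disc R (?H u) - flow I f g \<sigma> u\<bar> \<le> 4))"
    unfolding balanceable_def by auto
  have flagged: "\<forall>i\<in>I. H (f i) \<noteq> {} \<and> H (g i) \<noteq> {}" using I(2) by auto
  show ?thesis
  proof (rule balanceableI[of I _ _ f g])
    show "I \<subseteq> E" using I by auto
    show "\<forall>i\<in>I. H (f i) \<noteq> {} \<and> H (g i) \<noteq> {}" by fact
    fix \<sigma> :: "'e \<Rightarrow> int" assume \<sigma>: "\<forall>i. \<sigma> i = 1 \<or> \<sigma> i = - 1"
    from R[OF \<sigma>] obtain R where R: "factor en' (V - {v}) (E - {d, e}) R"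
      "\<And>u. u \<in> V - {v} \<Longrightarrow> \<bar>disc R (?H u) - flow I f g \<sigma> u\<bar> \<le> 4"
      by auto
    have RE: "R \<subseteq> E - {d, e}" using R unfolding factor_def by auto
    let ?R = "if disc R (?H a) \<le> flow I f g \<sigma> a then insert d R else insert e R"
    have "\<bar>disc ?R (H u) - flow I f g \<sigma> u\<bar> \<le> 4" if u: "u \<in> V" for u
    proof (cases "u = v")
      case True
      have "flow I f g \<sigma> v = 0" using flagged H(2) by (intro flow_eq_0) metis
      then show ?thesis using True H(2) by simp
    next
      case False
      have finH: "finite (?H u)" using H(1) fin finite_subset by blast
      have base: "disc ?R (?H u) = disc R (?H u)" by (intro disc_cong) auto
      show ?thesis
      proof (cases "d \<in> H u")
        case True
        then have "H u = insert d (?H u)" "u = a" using flag by auto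
        then have "disc ?R (H u) = (if d \<in> ?R then 1 else - 1) + disc R (?H u)"
          using disc_insert[of "?H u" d ?R] finH base by simp
        moreover have "d \<in> ?R \<longleftrightarrow> disc R (?H a) \<le> flow I f g \<sigma> a" using RE de by auto
        ultimately show ?thesis using R(2)[of u] u False \<open>u = a\<close> by auto
      next
        case no: False
        then have "H u = ?H u" using flag by auto
        then show ?thesis using R(2)[of u] u False base by simp
      qed
    qed
    moreover have "factor en V E ?R" using ext[OF R(1)] by auto
    ultimately show "\<exists>R. factor en V E R \<and> (\<forall>u\<in>V. \<bar>disc R (H u) - flow I f g \<sigma> u\<bar> \<le> 4)" by blast
  qed
qed

text \<open>The merged edge inherits the flag of \<open>e1\<close> at \<open>a\<close> and that of
  \<open>e2\<close> at \<open>b\<close>. After splitting, both halves have its colour and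
  \<open>e3\<close> counts nowhere, so the discrepancies agree exactly.\<close>

lemma balanceable_merge:
  fixes en :: "'e \<Rightarrow> 'v set"
  assumes cub: "cubic en V E v e1 a e2 b e3 c" and ab: "a \<noteq> b" and fin: "finite E"
    and H: "\<And>u. H u \<subseteq> incident en E u" "H v = {}" "\<And>u. e3 \<notin> H u"
    and bal: "balanceable (en(e1 := {a, b})) (V - {v}) (E - {e2, e3})
      (\<lambda>u. if e2 \<in> H u then insert e1 (H u - {e2}) else H u)" (is "balanceable ?en ?V ?E ?H")
  shows "balanceable en V E H"
proof -
  from bal obtain I f g where I: "I \<subseteq> ?E" "\<forall>i\<in>I. ?H (f i) \<noteq> {} \<and> ?H (g i) \<noteq> {}"
    and R: "\<And>\<sigma>. (\<forall>i. \<sigma> i = 1 \<or> \<sigma> i = - 1) \<Longrightarrow>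
       (\<exists>R. factor ?en ?V ?E R \<and> (\<forall>u\<in>?V. \<bar>disc R (?H u) - flow I f g \<sigma> u\<bar> \<le> 4))"
    unfolding balanceable_def by auto
  have flagged: "\<forall>i\<in>I. H (f i) \<noteq> {} \<and> H (g i) \<noteq> {}" using I(2) by (metis (full_types) empty_iff)
  \<comment> \<open>\<open>a \<noteq> b\<close> leaves \<open>v\<close> as the only common end of
    \<open>e1\<close> and \<open>e2\<close>, so the merged edge never stands for two counted edges
    at one vertex.\<close>
  have both: "e1 \<notin> H u" if "e2 \<in> H u" for u
  proof
    assume "e1 \<in> H u"
    then have "u \<in> en e1" "u \<in> en e2" using that H(1)[of u] unfolding incident_def by auto
    then have "u = v" using cub ab unfolding cubic_def by auto
    then show False using H(2) that by simp
  qed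
  have e12: "e1 \<noteq> e2" "e1 \<noteq> e3" "e2 \<noteq> e3" using cub unfolding cubic_def by auto
  show ?thesis
  proof (rule balanceableI[of I _ _ f g])
    show "I \<subseteq> E" using I by auto
    show "\<forall>i\<in>I. H (f i) \<noteq> {} \<and> H (g i) \<noteq> {}" by fact
    fix \<sigma> :: "'e \<Rightarrow> int" assume \<sigma>: "\<forall>i. \<sigma> i = 1 \<or> \<sigma> i = - 1"
    from R[OF \<sigma>] obtain R where R: "factor ?en ?V ?E R"
      "\<And>u. u \<in> ?V \<Longrightarrow> \<bar>disc R (?H u) - flow I f g \<sigma> u\<bar> \<le> 4"
      by auto
    have RE: "R \<subseteq> ?E" using R unfolding factor_def by auto
    let ?R = "insert (if e1 \<in> R then e2 else e3) R"
    have "\<bar>disc ?R (H u) - flow I f g \<sigma> u\<bar> \<le> 4" if u: "u \<in> V" for u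
    proof (cases "u = v")
      case True
      have "flow I f g \<sigma> v = 0" using flagged H(2) by (intro flow_eq_0) metis
      then show ?thesis using True H(2) by simp
    next
      case False
      have finH: "finite (H u)" using H(1)[of u] fin finite_subset unfolding incident_def by fastforce
      have base: "disc ?R (H u - {e2}) = disc R (H u - {e2})" using H(3) by (intro disc_cong) auto
      have "disc ?R (H u) = disc R (?H u)"
      proof (cases "e2 \<in> H u")
        case True
        then have "H u = insert e2 (H u - {e2})" by auto
        then have "disc ?R (H u) = (if e2 \<in> ?R then 1 else - 1) + disc R (H u - {e2})"
          using disc_insert[of "H u - {e2}" e2 ?R] finH base by simp
        moreover have "e2 \<in> ?R \<longleftrightarrow> e1 \<in> R" using RE e12 by auto
        moreover have "disc R (?H u) = (if e1 \<in> R then 1 else - 1) + disc R (H u - {e2})"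
          using disc_insert[of "H u - {e2}" e1 R] finH both[OF True] True by simp
        ultimately show ?thesis by simp
      next
        case False
        then have "H u - {e2} = H u" by auto
        then show ?thesis using base False by simp
      qed
      then show ?thesis using R(2)[of u] u False by simp
    qed
    then show "\<exists>R. factor en V E R \<and> (\<forall>u\<in>V. \<bar>disc R (H u) - flow I f g \<sigma> u\<bar> \<le> 4)"
      using factor_unmerge[OF cub R(1)] by blast
  qed
qed

section \<open>Existence of a reducible vertex and the induction\<close>

text \<open>Discharging: every edge distributes charge 6 among its ends, evenly except that an end of
  degree 3 takes 4. If the claim failed, every vertex would receive at least 12.\<close>

lemma factor_low_vertex:
  assumes R: "factor en V E R"
  shows "\<exists>v\<in>V. card (incident en E v) \<le> 3 \<and>
    (card (incident en E v) = 3 \<longrightarrow> (\<exists>e\<in>incident en E v. \<exists>u\<in>en e - {v}. card (incident en E u) \<le> 5))"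
proof (rule ccontr)
  let ?d = "\<lambda>v. card (incident en E v)"
  assume "\<not> ?thesis"
  then have neg: "\<not> (?d v \<le> 3 \<and> (?d v = 3 \<longrightarrow> (\<exists>e\<in>incident en E v. \<exists>u\<in>en e - {v}. ?d u \<le> 5)))"
    if "v \<in> V" for v using that by blast
  have deg: "?d v \<ge> 4 \<or> (?d v = 3 \<and> (\<forall>e\<in>incident en E v. \<forall>u\<in>en e - {v}. ?d u \<ge> 6))" if "v \<in> V" for v
  proof (cases "?d v \<le> 3")
    case True
    then have "?d v = 3" "\<not> (\<exists>e\<in>incident en E v. \<exists>u\<in>en e - {v}. ?d u \<le> 5)" using neg[OF that] by blast+
    moreover have "6 \<le> k" if "\<not> k \<le> 5" for k :: nat using that by simp
    ultimately show ?thesis by blast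
  qed simp
  \<comment> \<open>Under the negated claim no two vertices of degree 3 are adjacent, so a share of
    4 is always paired with a share of 2 at the other end.\<close>
  define c where "c e v = (if ?d v = 3 then 4 else if \<exists>u\<in>en e. ?d u = 3 then 2 else 3 :: nat)" for e v
  have RE: "R \<subseteq> E" and trees: "tree_set en V R" "tree_set en V (E - R)" using R unfolding factor_def by auto
  have fin: "finite V" "finite E" and on: "edge_set_on en V E"
    using trees RE finite_Diff2[of R E] unfolding tree_set_def edge_set_on_def by auto
  have "card E = card R + card (E - R)" using RE fin
    by (metis card_Diff_subset card_mono finite_subset le_add_diff_inverse)
  \<comment> \<open>Two spanning trees have \<open>2 * card V - 2\<close> edges, so a charge of 6
    per edge falls 12 short of 12 per vertex.\<close>
  then have cE: "card E + 2 = 2 * card V" using trees unfolding tree_set_def by auto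
  have "12 * card V \<le> (\<Sum>v\<in>V. \<Sum>e\<in>incident en E v. c e v)"
  proof -
    have "12 \<le> (\<Sum>e\<in>incident en E v. c e v)" if v: "v \<in> V" for v
    proof -
      consider "?d v = 3" | "?d v = 4 \<or> ?d v = 5" | "?d v \<ge> 6" using deg[OF v] by linarith
      then show ?thesis
      proof cases
        case 1
        then have "(\<Sum>e\<in>incident en E v. c e v) = (\<Sum>e\<in>incident en E v. 4)" unfolding c_def by simp
        then show ?thesis using 1 by simp
      next
        case 2
        \<comment> \<open>A neighbour of degree 3 would force degree at least 6 on \<open>v\<close>,
          so each of the four or five edges gives 3.\<close>
        have "c e v = 3" if e: "e \<in> incident en E v" for e
        proof -
          have "?d u \<noteq> 3" if u: "u \<in> en e" for u
          proof
            assume "?d u = 3"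
            then have "u \<noteq> v" using 2 by auto
            moreover have "u \<in> V" "e \<in> incident en E u" "v \<in> en e"
              using u e on unfolding incident_def edge_set_on_def by auto
            ultimately have "?d v \<ge> 6" using deg[of u] \<open>?d u = 3\<close> by auto
            then show False using 2 by auto
          qed
          then show ?thesis using 2 unfolding c_def by auto
        qed
        then have "(\<Sum>e\<in>incident en E v. c e v) = (\<Sum>e\<in>incident en E v. 3)" by simp
        then show ?thesis using 2 by auto
      next
        case 3
        have "?d v * 2 \<le> (\<Sum>e\<in>incident en E v. c e v)"
          using sum_bounded_below[of "incident en E v" 2 "\<lambda>e. c e v"] unfolding c_def by simp
        then show ?thesis using 3 by linarith
      qed
    qed
    then have "card V * 12 \<le> (\<Sum>v\<in>V. \<Sum>e\<in>incident en E v. c e v)"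
      using sum_bounded_below[of V 12 "\<lambda>v. \<Sum>e\<in>incident en E v. c e v"] by simp
    then show ?thesis by simp
  qed
  also have "\<dots> = (\<Sum>e\<in>E. \<Sum>v\<in>{v \<in> V. v \<in> en e}. c e v)"
    using sum.swap_restrict[OF fin, of "\<lambda>v e. c e v" "\<lambda>v e. v \<in> en e"] unfolding incident_def by simp
  also have "\<dots> \<le> (\<Sum>e\<in>E. 6)"
  proof (rule sum_mono)
    fix e assume e: "e \<in> E"
    then obtain x y where xy: "en e = {x, y}" "x \<noteq> y" "x \<in> V" "y \<in> V"
      using on unfolding edge_set_on_def by (metis card_2_iff insert_subset)
    have inc: "e \<in> incident en E x" "e \<in> incident en E y" using e xy unfolding incident_def by auto
    have "{v \<in> V. v \<in> en e} = {x, y}" using xy by auto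
    then have "(\<Sum>v\<in>{v \<in> V. v \<in> en e}. c e v) = c e x + c e y" using xy by simp
    moreover have "?d y \<ge> 6" if "?d x = 3" using deg[OF xy(3)] that inc xy by auto
    moreover have "?d x \<ge> 6" if "?d y = 3" using deg[OF xy(4)] that inc xy by auto
    ultimately show "(\<Sum>v\<in>{v \<in> V. v \<in> en e}. c e v) \<le> 6" unfolding c_def using xy by auto
  qed
  also have "\<dots> = 6 * card E" by simp
  finally show False using cE by linarith
qed

text \<open>With \<open>e2\<close> and \<open>e3\<close> red, an exchange at \<open>v\<close> brings
  in \<open>e1\<close>. Dropping \<open>e3\<close> would give \<open>e1\<close> and
  \<open>e2\<close> equal colours, which \<open>diff\<close> forbids, so \<open>e2\<close> is
  dropped. By symmetry \<open>e3\<close> can thus be merged with either of \<open>e1\<close>,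
  \<open>e2\<close>.\<close>

lemma cubic_choice:
  assumes cub: "cubic en V E v e1 a e2 b e3 c" and R: "factor en V E R"
    and diff: "\<And>R. factor en V E R \<Longrightarrow> e1 \<in> R \<longleftrightarrow> e2 \<notin> R"
  shows "\<exists>R. factor en V E R \<and> e3 \<in> R \<and> e1 \<in> R"
proof -
  have ne: "e1 \<noteq> e2" "e1 \<noteq> e3" "e2 \<noteq> e3" using cub unfolding cubic_def by auto
  obtain S where S: "factor en V E S" "e3 \<in> S"
    using R factor_Compl[OF R] cubic_edges[OF cub] by (cases "e3 \<in> R") auto
  show ?thesis
  proof (cases "e1 \<in> S")
    case True then show ?thesis using S by auto
  next
    case False
    then have "e2 \<in> S" using diff[OF S(1)] by auto
    have "cubic en V E v e3 c e2 b e1 a" using cubic_swap13[OF cub] .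
    from factor_exchange[OF this S \<open>e2 \<in> S\<close>]
    consider "factor en V E (insert e1 (S - {e3}))" | "factor en V E (insert e1 (S - {e2}))" by auto
    then show ?thesis
    proof cases
      case 1 then show ?thesis using diff[OF 1] \<open>e2 \<in> S\<close> ne by auto
    next
      case 2 then show ?thesis using S ne by auto
    qed
  qed
qed

text \<open>\<open>e3\<close> shares its colour with one of \<open>e1\<close>, \<open>e2\<close>;
  the exchange is made in that colour. The alternative removing \<open>e3\<close> makes
  \<open>e1\<close> and \<open>e2\<close> equal in colour and is excluded by \<open>diff\<close>;
  the other one swaps them.\<close>

lemma cubic_flip:
  assumes cub: "cubic en V E v e1 a e2 b e3 c"
    and diff: "\<And>R. factor en V E R \<Longrightarrow> e1 \<in> R \<longleftrightarrow> e2 \<notin> R"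
    and R: "factor en V E R" "e1 \<in> R"
  shows "factor en V E (insert e2 (R - {e1}))"
proof -
  have ne: "e1 \<noteq> e2" "e1 \<noteq> e3" "e2 \<noteq> e3" using cub unfolding cubic_def by auto
  have eE: "e1 \<in> E" "e2 \<in> E" "e3 \<in> E" using cubic_edges[OF cub] by auto
  have e2: "e2 \<notin> R" using diff[OF R(1)] R(2) by auto
  have RE: "R \<subseteq> E" using R unfolding factor_def by auto
  show ?thesis
  proof (cases "e3 \<in> R")
    case True
    from factor_exchange[OF cubic_swap23[OF cub] R True]
    consider "factor en V E (insert e2 (R - {e1}))" | "factor en V E (insert e2 (R - {e3}))" by auto
    then show ?thesis
    proof cases
      case 2 then show ?thesis using diff[OF 2] R(2) ne by auto
    qed
  next
    case False
    have "cubic en V E v e2 b e3 c e1 a" using cubic_swap23[OF cubic_swap12[OF cub]] .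
    from factor_exchange[OF this factor_Compl[OF R(1)]]
    consider "factor en V E (insert e1 (E - R - {e2}))" | "factor en V E (insert e1 (E - R - {e3}))"
      using eE e2 False by auto
    then show ?thesis
    proof cases
      case 1
      have "E - insert e1 (E - R - {e2}) = insert e2 (R - {e1})" using RE eE e2 ne by auto
      then show ?thesis using factor_Compl[OF 1] by simp
    next
      case 2 then show ?thesis using diff[OF 2] eE e2 ne by auto
    qed
  qed
qed

text \<open>Merging re-attaches edges and every reduction changes flags, so the induction ranges
  over all incidence maps and flag families.\<close>

lemma factor_balanceable:
  assumes "factor en V E R" "\<And>u. H u \<subseteq> incident en E u"
  shows "balanceable en V E H"
  using assms
proof (induction "card V" arbitrary: en V E R H rule: less_induct)
  case less
  note R = less.prems(1)
  have RE: "R \<subseteq> E" and trees: "tree_set en V R" "tree_set en V (E - R)" using R unfolding factor_def by auto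
  have fin: "finite V" "finite E" and on: "edge_set_on en V E"
    using trees RE finite_Diff2[of R E] unfolding tree_set_def edge_set_on_def by auto
  show ?case
  proof (cases "card V \<ge> 2")
    case False
    have "card R = 0" "card (E - R) = 0" using trees False unfolding tree_set_def by auto
    then have "E = {}" using fin finite_subset[OF RE] by auto
    then have "H u = {}" for u using less.prems(2)[of u] unfolding incident_def by auto
    then show ?thesis unfolding balanceable_def using R
      by (intro exI[of _ "{}"] exI) (auto simp: flow_def)
  next
    case big: True
    \<comment> \<open>Flags at vertices of degree at most 5 are dropped at once, so the reducible
      vertex \<open>v\<close> has none. \<open>balanceable_drop\<close> restores them at the
      end.\<close>
    define K where "K = (\<lambda>u. if card (incident en E u) \<le> 5 then {} else H u)"
    have K: "K u \<subseteq> incident en E u" for u using less.prems(2) unfolding K_def by auto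
    have KE: "K u \<subseteq> E" for u using K[of u] unfolding incident_def by auto
    have K_end: "u = x" if "e \<in> K u" "en e = {v, x}" "K v = {}" for u e x v
      using that K[of u] unfolding incident_def by auto
    have smaller: "card (V - {v}) < card V" if "v \<in> V" for v
      using fin that by (meson card_Diff1_less)
    obtain v where v: "v \<in> V" "card (incident en E v) \<le> 3"
      and three: "card (incident en E v) = 3 \<longrightarrow>
        (\<exists>e\<in>incident en E v. \<exists>u\<in>en e - {v}. card (incident en E u) \<le> 5)"
      using factor_low_vertex[OF R] by auto
    have Kv: "K v = {}" using v unfolding K_def by auto
    obtain d e where de: "d \<in> incident en E v" "d \<in> R" "e \<in> incident en E v" "e \<notin> R"
      using factor_both_colours[OF R v(1) big] by auto
    then have dne: "d \<noteq> e" and deE: "d \<in> E" "e \<in> E" unfolding incident_def by auto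
    have fini: "finite (incident en E v)" using fin unfolding incident_def by auto
    have other: "\<exists>x. en e = {v, x} \<and> x \<in> V - {v}" if "e \<in> incident en E v" for e
      using that edge_set_on_other_end[OF on, of e v] unfolding incident_def by blast
    have "balanceable en V E K"
    proof (cases "card (incident en E v) = 3")
      case False
      \<comment> \<open>Both colours occur at \<open>v\<close>, so a degree below 3 is exactly
        2.\<close>
      have "{d, e} \<subseteq> incident en E v" using de by auto
      moreover have "card {d, e} = 2" using dne by auto
      ultimately have inc: "incident en E v = {d, e}"
        using v(2) False fini card_seteq[of "incident en E v" "{d, e}"] by auto
      obtain a b where ends: "en d = {v, a}" "a \<in> V - {v}" "en e = {v, b}" "b \<in> V - {v}"
        using other de by meson
      have "factor en (V - {v}) (E - {d, e}) (R - {d, e})"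
        using factor_delete[OF R v(1) inc] ends de by auto
      then have IH: "balanceable en (V - {v}) (E - {d, e}) (\<lambda>u. K u - {d, e})"
        using K by (intro less.hyps[OF smaller[OF v(1)]]) (auto simp: incident_def)
      have ext: "factor en V E (insert d S) \<and> factor en V E (insert e S)"
        if S: "factor en (V - {v}) (E - {d, e}) S" for S
        using factor_insert[OF S v(1) inc dne ends(1,3)] 
          factor_insert[of en V v E e d S b a] S v(1) inc dne ends by (auto simp: insert_commute)
      have flag: "d \<in> K u \<Longrightarrow> u = a" "e \<in> K u \<Longrightarrow> u = b" for u using K_end ends Kv by blast+
      \<comment> \<open>Two flagged edges become a link; if one is unflagged, the other is free to
        correct the error at its far end.\<close>
      consider "d \<in> K a" "e \<in> K b" | "e \<notin> K b" | "d \<notin> K a" by blast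
      then show ?thesis
      proof cases
        case 1
        show ?thesis by (rule balanceable_link[OF IH KE Kv fin(2) deE dne _ _ ext]) (use flag 1 in auto)
      next
        case 2
        show ?thesis by (rule balanceable_one_sided[OF IH KE Kv fin(2) deE dne _ _ ext]) (use flag 2 in auto)
      next
        case 3
        show ?thesis
          by (rule balanceable_one_sided[of en V v E e d K b en])
            (use IH KE Kv fin(2) deE dne flag 3 ext in \<open>auto simp: insert_commute\<close>)
      qed
    next
      case True
      have merge: "balanceable en V E K"
        if cub: "cubic en V E v e1 a e2 b e3 c" and flag: "\<And>u. e3 \<notin> K u"
          and S: "factor en V E S" "e1 \<in> S \<longleftrightarrow> e2 \<in> S" for e1 a e2 b e3 c S
      proof -
        have eE: "e1 \<in> E" "e2 \<in> E" "e3 \<in> E" using cubic_edges[OF cub] by auto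
        have c: "e1 \<noteq> e2" "e1 \<noteq> e3" "e2 \<noteq> e3" "en e1 = {v, a}" "en e2 = {v, b}"
          using cub unfolding cubic_def by auto
        \<comment> \<open>Complementing if necessary, the common colour is red.\<close>
        obtain T where T: "factor en V E T" "e1 \<in> T" "e2 \<in> T"
          using S factor_Compl[OF S(1)] eE by (cases "e1 \<in> S") auto
        note m = factor_merge[OF cub T]
        let ?K = "\<lambda>u. if e2 \<in> K u then insert e1 (K u - {e2}) else K u"
        have "?K u \<subseteq> incident (en(e1 := {a, b})) (E - {e2, e3}) u" for u
        proof
          fix x assume x: "x \<in> ?K u"
          show "x \<in> incident (en(e1 := {a, b})) (E - {e2, e3}) u"
          proof (cases "x = e1")
            case True
            have "u = b" if "e2 \<in> K u" using K_end[OF that c(5) Kv] .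
            moreover have "u = a" if "e1 \<in> K u" using K_end[OF that c(4) Kv] .
            ultimately have "u \<in> {a, b}" using x True by (auto split: if_splits)
            then show ?thesis using True c eE unfolding incident_def by auto
          next
            case False
            then have "x \<in> K u" "x \<noteq> e2" using x by (auto split: if_splits)
            moreover then have "x \<noteq> e3" using flag by auto
            ultimately show ?thesis using K[of u] False unfolding incident_def by auto
          qed
        qed
        then have "balanceable (en(e1 := {a, b})) (V - {v}) (E - {e2, e3}) ?K"
          by (rule less.hyps[OF smaller[OF v(1)] m(3)])
        then show ?thesis using balanceable_merge[OF cub m(2) fin(2) K Kv flag] by simp
      qed
      obtain e3 c where e3: "e3 \<in> incident en E v" "c \<in> en e3 - {v}" "card (incident en E c) \<le> 5"
        using three True by auto
      then have c: "en e3 = {v, c}" "c \<in> V - {v}" using other[OF e3(1)] by auto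
      \<comment> \<open>A flag of \<open>e3\<close> could only sit at \<open>c\<close>, where the
        small degree has removed all flags.\<close>
      have flag3: "e3 \<notin> K u" for u
      proof
        assume u: "e3 \<in> K u"
        have "u = c" using K_end[OF u c(1) Kv] .
        then show False using u e3(3) unfolding K_def by auto
      qed
      have "card (incident en E v - {e3}) = 2" using True e3(1) fini by simp
      then obtain e1 e2 where e12: "incident en E v - {e3} = {e1, e2}" "e1 \<noteq> e2" by (auto simp: card_2_iff)
      then have inc: "e1 \<in> incident en E v" "e2 \<in> incident en E v" "e1 \<noteq> e3" "e2 \<noteq> e3" by auto
      have incv: "incident en E v = {e1, e2, e3}" using e12 e3(1) by auto
      obtain a b where ends: "en e1 = {v, a}" "a \<in> V - {v}" "en e2 = {v, b}" "b \<in> V - {v}"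
        using other inc by meson
      have cub: "cubic en V E v e1 a e2 b e3 c"
        unfolding cubic_def using v(1) incv inc e12(2) ends c by auto
      have eE: "e1 \<in> E" "e2 \<in> E" "e3 \<in> E" using cubic_edges[OF cub] by auto
      show ?thesis
      proof (cases "\<exists>S. factor en V E S \<and> (e1 \<in> S \<longleftrightarrow> e2 \<in> S)")
        case True
        then show ?thesis using merge[OF cub flag3] by blast
      next
        case False
        then have diff: "e1 \<in> S \<longleftrightarrow> e2 \<notin> S" "e2 \<in> S \<longleftrightarrow> e1 \<notin> S" if "factor en V E S" for S
          using that by auto
        obtain S where S: "factor en V E S" "e3 \<in> S" "e1 \<in> S"
          using cubic_choice[OF cub R diff(1)] by blast
        obtain S' where S': "factor en V E S'" "e3 \<in> S'" "e2 \<in> S'"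
          using cubic_choice[OF cubic_swap12[OF cub] R diff(2)] by blast
        have cub': "cubic en V E v e3 c e1 a e2 b" using cubic_swap12[OF cubic_swap23[OF cub]] .
        \<comment> \<open>If \<open>e1\<close> or \<open>e2\<close> is unflagged, it takes the role
          of the third edge, and the other one is merged with \<open>e3\<close>, as
          \<open>S'\<close> or \<open>S\<close> permits.\<close>
        consider "\<forall>u. e1 \<notin> K u" | "\<forall>u. e2 \<notin> K u" | "e1 \<in> K a" "e2 \<in> K b"
          using K_end[OF _ ends(1) Kv] K_end[OF _ ends(3) Kv] by blast
        then show ?thesis
        proof cases
          case 1
          show ?thesis using merge[OF cubic_swap13[OF cub] _ S'(1)] 1 S' by blast
        next
          case 2
          show ?thesis using merge[OF cub' _ S(1)] 2 S by blast
        next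
          case 3
          \<comment> \<open>Merging \<open>e3\<close> with \<open>e1\<close> gives the smaller
            factorization for the induction; \<open>e1\<close> and \<open>e2\<close> are unflagged
            there and become a link.\<close>
          have "K u - {e1, e2} \<subseteq> incident (en(e3 := {c, a})) (E - {e1, e2}) u" for u
            using K[of u] flag3[of u] unfolding incident_def by auto
          then have IH: "balanceable (en(e3 := {c, a})) (V - {v}) (E - {e1, e2}) (\<lambda>u. K u - {e1, e2})"
            by (rule less.hyps[OF smaller[OF v(1)] factor_merge(3)[OF cub' S]])
          \<comment> \<open>Splitting yields one of the two insertions, according to the colour of
            \<open>e3\<close>; \<open>cubic_flip\<close> yields the other.\<close>
          have ext: "factor en V E (insert e1 T) \<and> factor en V E (insert e2 T)"
            if T: "factor (en(e3 := {c, a})) (V - {v}) (E - {e1, e2}) T" for T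
          proof -
            have TE: "T - {e1} = T" "T - {e2} = T" using T unfolding factor_def by auto
            show ?thesis
            proof (cases "e3 \<in> T")
              case True
              then have 1: "factor en V E (insert e1 T)" using factor_unmerge[OF cub' T] by simp
              from cubic_flip[OF cub diff(1) this] have "factor en V E (insert e2 T)" using TE by simp
              with 1 show ?thesis by simp
            next
              case False
              then have 2: "factor en V E (insert e2 T)" using factor_unmerge[OF cub' T] by simp
              from cubic_flip[OF cubic_swap12[OF cub] diff(2) this] have "factor en V E (insert e1 T)"
                using TE by simp
              with 2 show ?thesis by simp
            qed
          qed
          have "e1 \<in> K u \<longleftrightarrow> u = a" "e2 \<in> K u \<longleftrightarrow> u = b" for u
            using 3 K_end[OF _ ends(1) Kv, of u] K_end[OF _ ends(3) Kv, of u] by blast+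
          from balanceable_link[OF IH KE Kv fin(2) eE(1,2) e12(2) this ext] show ?thesis .
        qed
      qed
    qed
    then show ?thesis using balanceable_drop[OF fin(2) big less.prems(2)] unfolding K_def by simp
  qed
qed

section \<open>Trees as connected acyclic graphs\<close>

text \<open>A walk that returns to an earlier vertex is cut off there.\<close>

lemma rtranclp_distinct_path:
  assumes "r\<^sup>*\<^sup>* u w"
  shows "\<exists>vs. vs \<noteq> [] \<and> distinct vs \<and> hd vs = u \<and> last vs = w \<and>
    (\<forall>i. Suc i < length vs \<longrightarrow> r (vs ! i) (vs ! Suc i))"
  using assms
proof (induction rule: rtranclp_induct)
  case base
  show ?case by (intro exI[of _ "[u]"]) auto
next
  case (step y z)
  then obtain vs where vs: "vs \<noteq> []" "distinct vs" "hd vs = u" "last vs = y"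
    "\<And>i. Suc i < length vs \<Longrightarrow> r (vs ! i) (vs ! Suc i)" by blast
  show ?case
  proof (cases "z \<in> set vs")
    case True
    then obtain xs ys where xy: "vs = xs @ z # ys" by (auto simp: in_set_conv_decomp)
    have "r ((xs @ [z]) ! i) ((xs @ [z]) ! Suc i)" if i: "Suc i < length (xs @ [z])" for i
    proof -
      have "(xs @ [z]) ! k = vs ! k" if "k < length (xs @ [z])" for k
        using that unfolding xy by (auto simp: nth_append less_Suc_eq)
      then show ?thesis using vs(5)[of i] i unfolding xy by auto
    qed
    then show ?thesis using vs xy by (intro exI[of _ "xs @ [z]"]) (cases xs; auto)
  next
    case False
    have "r ((vs @ [z]) ! i) ((vs @ [z]) ! Suc i)" if i: "Suc i < length (vs @ [z])" for i
    proof (cases "Suc i < length vs")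
      case True then show ?thesis using vs(5)[of i] by (auto simp: nth_append)
    next
      case False
      then have "Suc i = length vs" using i by auto
      then show ?thesis using step.hyps(2) vs(1,4) by (auto simp: nth_append last_conv_nth Suc_diff_1[symmetric])
        (metis diff_Suc_1')
    qed
    then show ?thesis using vs False by (intro exI[of _ "vs @ [z]"]) auto
  qed
qed

text \<open>Connectedness provides a spanning set of \<open>card V - 1\<close> edges; an edge
  outside it would close a path to a cycle.\<close>

lemma is_tree_imp_tree_set:
  assumes T: "is_tree T"
  shows "tree_set (ends T) (vertices T) (edges T)"
proof -
  let ?en = "ends T" and ?V = "vertices T" and ?E = "edges T"
  have fin: "finite ?V" and on: "edge_set_on ?en ?V ?E" and ne: "?V \<noteq> {}"
    using T unfolding is_tree_def finite_multigraph_def connected_graph_def edge_set_on_def by auto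
  have spans: "spans ?en ?V ?E"
    unfolding spans_def
  proof (intro allI impI subsetI)
    fix X w assume X: "closed_under ?en ?E X" "?V \<inter> X \<noteq> {}" and w: "w \<in> ?V"
    then obtain u where u: "u \<in> ?V" "u \<in> X" by auto
    have "(adjacent_in T)\<^sup>*\<^sup>* u w" using T u w unfolding is_tree_def connected_graph_def by auto
    then show "w \<in> X"
    proof (induction rule: rtranclp_induct)
      case base show ?case by fact
    next
      case (step y z)
      then show ?case using closed_under_edge[OF X(1)] unfolding adjacent_in_def by blast
    qed
  qed
  obtain S where S: "S \<subseteq> ?E" "card S + 1 = card ?V" "spans ?en ?V S"
    using spanning_subset[OF fin ne spans on] .
  have "S = ?E"
  proof (rule ccontr)
    assume "S \<noteq> ?E"
    then obtain e where e: "e \<in> ?E" "e \<notin> S" using S(1) by auto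
    obtain u w where uw: "?en e = {u, w}" "u \<noteq> w" "u \<in> ?V" "w \<in> ?V"
      using on e(1) unfolding edge_set_on_def by (metis card_2_iff insert_subset)
    define r where "r x y \<longleftrightarrow> (\<exists>e\<in>S. ?en e = {x, y})" for x y
    have "closed_under ?en S {x. r\<^sup>*\<^sup>* u x}"
      unfolding closed_under_def
    proof (intro ballI impI subsetI)
      fix d y assume d: "d \<in> S" "?en d \<inter> {x. r\<^sup>*\<^sup>* u x} \<noteq> {}" "y \<in> ?en d"
      then obtain x where x: "x \<in> ?en d" "r\<^sup>*\<^sup>* u x" by auto
      obtain x' where "?en d = {x, x'}" using edge_set_on_other_end[OF on _ x(1)] d S(1) by blast
      then have "y = x \<or> r x y" using d unfolding r_def by auto
      then show "y \<in> {x. r\<^sup>*\<^sup>* u x}" using x(2) by auto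
    qed
    then have "r\<^sup>*\<^sup>* u w" using spansD[OF S(3) _ uw(3)] uw(4) by blast
    then obtain vs where vs: "vs \<noteq> []" "distinct vs" "hd vs = u" "last vs = w"
      "\<And>i. Suc i < length vs \<Longrightarrow> r (vs ! i) (vs ! Suc i)" using rtranclp_distinct_path by metis
    define n where "n = length vs - 1"
    have len: "length vs = Suc n" using vs(1) unfolding n_def by (cases vs) auto
    have ends: "vs ! 0 = u" "vs ! n = w" using vs len by (auto simp: hd_conv_nth last_conv_nth)
    then have "n \<ge> 1" using uw(2) by (cases n) auto
    obtain h where h: "\<And>i. i < n \<Longrightarrow> h i \<in> S \<and> ?en (h i) = {vs ! i, vs ! Suc i}"
      using vs(5) len unfolding r_def by (metis Suc_less_eq)
    \<comment> \<open>\<open>e\<close> sits at the last index \<open>n\<close>, where the cyclic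
      successor of \<open>w\<close> is \<open>u\<close>. A path of one edge yields a cycle of two
      parallel edges.\<close>
    define es where "es = map h [0..<n] @ [e]"
    have "inj_on h {0..<n}"
    proof (rule inj_onI)
      fix i j assume ij: "i \<in> {0..<n}" "j \<in> {0..<n}" "h i = h j"
      then have eq: "{vs ! i, vs ! Suc i} = {vs ! j, vs ! Suc j}" using h[of i] h[of j] by auto
      have "vs ! k = vs ! l \<longleftrightarrow> k = l" if "k \<le> n" "l \<le> n" for k l
        using that vs(2) len by (simp add: nth_eq_iff_index_eq)
      then show "i = j" using eq ij by (auto simp: doubleton_eq_iff)
    qed
    moreover have "e \<notin> h ` {0..<n}" using h e(2) by auto
    ultimately have "distinct es" unfolding es_def by (auto simp: distinct_map)
    moreover have "set es \<subseteq> ?E" using h S(1) e(1) unfolding es_def by auto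
    moreover have "?en (es ! i) = {vs ! i, vs ! (Suc i mod length vs)}" if "i < length es" for i
    proof (cases "i < n")
      case True
      then show ?thesis using h[of i] len unfolding es_def by (auto simp: nth_append)
    next
      case False
      then have "i = n" using that unfolding es_def by auto
      then show ?thesis using uw(1) ends len unfolding es_def by (auto simp: nth_append)
    qed
    moreover have "length vs = length es" "length es \<ge> 2" using len \<open>n \<ge> 1\<close> unfolding es_def by auto
    ultimately have "is_cycle T vs es" using vs(2) unfolding is_cycle_def by auto
    then show False using T unfolding is_tree_def by auto
  qed
  then show ?thesis using S fin on spans unfolding tree_set_def by auto
qed

text \<open>The first edge of a cycle is bypassed by the others, so the graph would stay connected
  without it, against minimality.\<close>

lemma tree_set_imp_is_tree:
  assumes T: "tree_set (ends T) (vertices T) (edges T)"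
  shows "is_tree T"
proof -
  let ?en = "ends T" and ?V = "vertices T" and ?E = "edges T"
  have on: "edge_set_on ?en ?V ?E" and spans: "spans ?en ?V ?E" using T unfolding tree_set_def by auto
  have "finite_multigraph T"
    using T unfolding tree_set_def finite_multigraph_def edge_set_on_def by auto
  moreover have "connected_graph T"
    unfolding connected_graph_def
  proof (intro conjI ballI)
    show "?V \<noteq> {}" using T unfolding tree_set_def by auto
    fix u v assume uv: "u \<in> ?V" "v \<in> ?V"
    have "closed_under ?en ?E {x. (adjacent_in T)\<^sup>*\<^sup>* u x}"
      unfolding closed_under_def
    proof (intro ballI impI subsetI)
      fix d y assume d: "d \<in> ?E" "?en d \<inter> {x. (adjacent_in T)\<^sup>*\<^sup>* u x} \<noteq> {}" "y \<in> ?en d"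
      then obtain x where x: "x \<in> ?en d" "(adjacent_in T)\<^sup>*\<^sup>* u x" by auto
      obtain x' where "?en d = {x, x'}" using edge_set_on_other_end[OF on d(1) x(1)] by blast
      then have "y = x \<or> adjacent_in T x y" using d unfolding adjacent_in_def by auto
      then show "y \<in> {x. (adjacent_in T)\<^sup>*\<^sup>* u x}" using x(2) by auto
    qed
    then show "(adjacent_in T)\<^sup>*\<^sup>* u v" using spansD[OF spans _ uv(1)] uv(2) by blast
  qed
  moreover have False if "is_cycle T vs es" for vs es
  proof -
    define n where "n = length es"
    have c: "length vs = n" "n \<ge> 2" "distinct es" "set es \<subseteq> ?E"
      "\<And>i. i < n \<Longrightarrow> ?en (es ! i) = {vs ! i, vs ! (Suc i mod n)}"
      using that unfolding is_cycle_def n_def by auto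
    have esE: "es ! i \<in> ?E" if "i < n" for i using c(4) that unfolding n_def by auto
    have "closed_under ?en ?E X" if X: "closed_under ?en (?E - {es ! 0}) X" for X
    proof -
      have edge: "vs ! i \<in> X \<longleftrightarrow> vs ! (Suc i mod n) \<in> X" if "0 < i" "i < n" for i
      proof (rule closed_under_edge[OF X _ c(5)[OF that(2)]])
        have "0 < length es" using that unfolding n_def by linarith
        then show "es ! i \<in> ?E - {es ! 0}"
          using esE[OF that(2)] that nth_eq_iff_index_eq[OF c(3), of i 0] unfolding n_def by auto
      qed
      \<comment> \<open>The walk starts at index 1, since the deleted edge \<open>es ! 0\<close>
        joins \<open>vs ! 0\<close> and \<open>vs ! 1\<close>; the step from \<open>n - 1\<close>
        wraps around to 0.\<close>
      have walk: "i < n \<longrightarrow> (vs ! i \<in> X \<longleftrightarrow> vs ! 1 \<in> X)" if "1 \<le> i" for i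
        using that
      proof (induction i rule: dec_induct)
        case (step i)
        then show ?case using edge[of i] by auto
      qed simp
      have "vs ! (n - 1) \<in> X \<longleftrightarrow> vs ! 1 \<in> X" using walk[of "n - 1"] c(2) by simp
      moreover have "Suc (n - 1) mod n = 0" using c(2) by simp
      then have "vs ! (n - 1) \<in> X \<longleftrightarrow> vs ! 0 \<in> X" using edge[of "n - 1"] c(2) by simp
      moreover have "?en (es ! 0) = {vs ! 0, vs ! 1}" using c(5)[of 0] c(2) by simp
      ultimately have "?en (es ! 0) \<inter> X \<noteq> {} \<longrightarrow> ?en (es ! 0) \<subseteq> X" by auto
      then show ?thesis using X unfolding closed_under_def by blast
    qed
    then have "spans ?en ?V (?E - {es ! 0})" using spans unfolding spans_def by blast
    then show False using tree_set_minimal[OF T esE[of 0]] c(2) by auto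
  qed
  ultimately show ?thesis unfolding is_tree_def by blast
qed

section \<open>Return to graph records and the bound 5\<close>

lemma spanning_tree_of_tree_set:
  assumes "spanning_tree_of T G"
  shows "tree_set (ends G) (vertices G) (edges T)"
proof -
  have "tree_set (ends T) (vertices G) (edges T)"
    using is_tree_imp_tree_set assms unfolding spanning_tree_of_def by metis
  moreover have "ends T e = ends G e" if "e \<in> edges T" for e
    using assms that unfolding spanning_tree_of_def subgraph_of_def by auto
  ultimately show ?thesis using tree_set_cong by metis
qed

lemma tree_set_spanning_tree_of:
  assumes "tree_set (ends G) (vertices G) S" "S \<subseteq> edges G"
  shows "spanning_tree_of (G\<lparr>edges := S\<rparr>) G"
  using assms tree_set_imp_is_tree[of "G\<lparr>edges := S\<rparr>"]
  unfolding spanning_tree_of_def subgraph_of_def by auto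

theorem theorem2:
  fixes G :: "('v, 'e) multigraph"
  assumes "double_tree G"
  shows "\<exists>T1 T2. spanning_tree_factorization G [T1, T2] \<and>
    (\<forall>v\<in>vertices G. \<bar>int (vertex_degree T1 v) - int (vertex_degree T2 v)\<bar> \<le> 5)"
proof -
  let ?en = "ends G" and ?V = "vertices G" and ?E = "edges G"
  obtain Ts where Ts: "length Ts = 2" "spanning_tree_factorization G Ts" and finE: "finite ?E"
    using assms unfolding double_tree_def multiple_tree_def finite_multigraph_def by auto
  from Ts(1) obtain S1 S2 where S: "Ts = [S1, S2]" by (auto simp: numeral_2_eq_2 length_Suc_conv)
  have "spanning_tree_of S1 G" "spanning_tree_of S2 G" "edges S1 \<inter> edges S2 = {}" "edges S1 \<union> edges S2 = ?E"
    using Ts(2) unfolding S spanning_tree_factorization_def by force+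
  moreover from this have "edges S2 = ?E - edges S1" by auto
  ultimately have "factor ?en ?V ?E (edges S1)"
    unfolding factor_def using spanning_tree_of_tree_set by fastforce
  \<comment> \<open>Every edge is flagged at both ends, so discrepancies are full degree
    differences.\<close>
  from factor_balanceable[OF this, of "incident ?en ?E"] obtain I f g where I: "I \<subseteq> ?E"
    and bal: "\<And>\<sigma>. (\<forall>i. \<sigma> i = 1 \<or> \<sigma> i = - 1) \<Longrightarrow>
       \<exists>R. factor ?en ?V ?E R \<and> (\<forall>u\<in>?V. \<bar>disc R (incident ?en ?E u) - flow I f g \<sigma> u\<bar> \<le> 4)"
    unfolding balanceable_def by auto
  \<comment> \<open>The links are fixed before the signs, so balanced signs are chosen first and the
    factorization afterwards; the errors add up to 4 + 1.\<close>
  obtain \<sigma> where \<sigma>: "\<forall>i. \<sigma> i = 1 \<or> \<sigma> i = - 1" "\<And>u. \<bar>flow I f g \<sigma> u\<bar> \<le> 1"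
    using balanced_signs[OF finite_subset[OF I finE]] by metis
  obtain R where R: "factor ?en ?V ?E R"
    "\<And>u. u \<in> ?V \<Longrightarrow> \<bar>disc R (incident ?en ?E u) - flow I f g \<sigma> u\<bar> \<le> 4"
    using bal[OF \<sigma>(1)] by blast
  have RE: "R \<subseteq> ?E" using R(1) unfolding factor_def by auto
  let ?T1 = "G\<lparr>edges := R\<rparr>" and ?T2 = "G\<lparr>edges := ?E - R\<rparr>"
  have "spanning_tree_of ?T1 G" "spanning_tree_of ?T2 G"
    using R(1) RE tree_set_spanning_tree_of unfolding factor_def by blast+
  then have "spanning_tree_factorization G [?T1, ?T2]"
    unfolding spanning_tree_factorization_def using RE by (auto simp: less_Suc_eq nth_Cons')
  moreover have "\<bar>int (vertex_degree ?T1 v) - int (vertex_degree ?T2 v)\<bar> \<le> 5" if v: "v \<in> ?V" for v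
  proof -
    have "{e \<in> R. v \<in> ?en e} = incident ?en ?E v \<inter> R" "{e \<in> ?E - R. v \<in> ?en e} = incident ?en ?E v - R"
      using RE unfolding incident_def by auto
    then have "int (vertex_degree ?T1 v) - int (vertex_degree ?T2 v) = disc R (incident ?en ?E v)"
      using finE by (simp add: vertex_degree_def disc_eq_card incident_def)
    then show ?thesis using R(2)[OF v] \<sigma>(2)[of v] by linarith
  qed
  ultimately show ?thesis by blast
qed

end
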